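(* Let $l\ge 1$ be an integer, let $Z$ be a standard complex normal random variable, and for each $n\ge 1$ let $U_n$ be an $n\times n$ Haar unitary random matrix. Then $\operatorname{Tr}(U_n^l)$ converges in distribution to $\sqrt{l}\,Z$ as $n\to\infty$.
   Context: An $n\times n$ Haar unitary random matrix is a random matrix with values in the group $\mathcal U(n)$ of $n\times n$ complex unitary matrices, distributed according to the normalized Haar measure on $\mathcal U(n)$. $\operatorname{Tr}$ is the usual (unnormalized) trace, and $U_n^l$ is the $l$-th matrix power. A complex-valued random variable $\xi$ is called standard complex normal if $\operatorname{Re}\xi$ and $\operatorname{Im}\xi$ are independent and each normally distributed with mean $0$ and variance $1/2$. *)

theory Defs
  imports "HOL-Probability.Probability" "Jordan_Normal_Form.Schur_Decomposition"
begin

definition unitary_group :: "nat \<Rightarrow> complex mat set" where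
  "unitary_group n =
     {A \<in> carrier_mat n n. mat_adjoint A * A = 1\<^sub>m n \<and> A * mat_adjoint A = 1\<^sub>m n}"

definition mat_trace :: "'a :: comm_monoid_add mat \<Rightarrow> 'a" where
  "mat_trace A = (\<Sum>i<dim_row A. A $$ (i, i))"

text \<open>The matrix type carries no topology of its own.  An n-by-n matrix is read as the family of
  its entries, extended by 0 (the value of \<open>A $$ (i, j)\<close> is unspecified outside the index range);
  the entry families carry the product topology, and the unitary group gets the subspace topology,
  that is, the topology it has as a subset of the space of n-by-n complex matrices.\<close>

definition mat_entries :: "nat \<Rightarrow> complex mat \<Rightarrow> nat \<times> nat \<Rightarrow> complex" where
  "mat_entries n A = (\<lambda>(i, j). if i < n \<and> j < n then A $$ (i, j) else 0)"

definition unitary_topology :: "nat \<Rightarrow> complex mat topology" where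
  "unitary_topology n = pullback_topology (unitary_group n) (mat_entries n) euclidean"

definition unitary_borel :: "nat \<Rightarrow> complex mat measure" where
  "unitary_borel n = sigma (unitary_group n) {S. openin (unitary_topology n) S}"

text \<open>Left invariance and total mass 1 determine the measure; on a compact group right invariance
  then holds as well.\<close>

definition normalized_haar_unitary :: "nat \<Rightarrow> complex mat measure \<Rightarrow> bool" where
  "normalized_haar_unitary n \<mu> \<longleftrightarrow>
     prob_space \<mu> \<and> space \<mu> = unitary_group n \<and> sets \<mu> = sets (unitary_borel n) \<and>
     (\<forall>V\<in>unitary_group n. \<forall>S\<in>sets \<mu>. emeasure \<mu> ((\<lambda>A. V * A) ` S) = emeasure \<mu> S)"

definition haar_unitary_random_matrix :: "nat \<Rightarrow> 'a measure \<Rightarrow> ('a \<Rightarrow> complex mat) \<Rightarrow> bool" where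
  "haar_unitary_random_matrix n M U \<longleftrightarrow>
     U \<in> measurable M (unitary_borel n) \<and>
     normalized_haar_unitary n (distr M (unitary_borel n) U)"

text \<open>The second argument of \<^const>\<open>normal_density\<close> is the standard deviation.\<close>

definition standard_complex_normal :: "'a measure \<Rightarrow> ('a \<Rightarrow> complex) \<Rightarrow> bool" where
  "standard_complex_normal M Z \<longleftrightarrow>
     Z \<in> borel_measurable M \<and>
     prob_space.indep_var M borel (\<lambda>\<omega>. Re (Z \<omega>)) borel (\<lambda>\<omega>. Im (Z \<omega>)) \<and>
     distributed M lborel (\<lambda>\<omega>. Re (Z \<omega>)) (normal_density 0 (sqrt (1 / 2))) \<and>
     distributed M lborel (\<lambda>\<omega>. Im (Z \<omega>)) (normal_density 0 (sqrt (1 / 2)))"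

text \<open>The library's \<^const>\<open>weak_conv_m\<close> is stated with distribution functions and is only available
  for measures on the real line.\<close>

definition weakly_converges ::
    "(nat \<Rightarrow> 'a :: topological_space measure) \<Rightarrow> 'a measure \<Rightarrow> bool" where
  "weakly_converges \<mu> \<nu> \<longleftrightarrow>
     (\<forall>f :: 'a \<Rightarrow> real. continuous_on UNIV f \<longrightarrow> bounded (range f) \<longrightarrow>
        (\<lambda>n. \<integral>x. f x \<partial>\<mu> n) \<longlonglongrightarrow> (\<integral>x. f x \<partial>\<nu>))"

text \<open>The random variables may live on different probability spaces.\<close>

definition converges_in_distribution ::
    "(nat \<Rightarrow> 'a measure) \<Rightarrow> (nat \<Rightarrow> 'a \<Rightarrow> 'c :: topological_space) \<Rightarrow>
     'b measure \<Rightarrow> ('b \<Rightarrow> 'c) \<Rightarrow> bool" where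
  "converges_in_distribution M X N Y \<longleftrightarrow>
     weakly_converges (\<lambda>n. distr (M n) borel (X n)) (distr N borel Y)"

end

theory Submission
  imports Defs
begin

text \<open>Put \<open>p\<^sub>k = Tr U\<^sup>k\<close>.  For a projection \<open>P\<close> the matrices \<open>e\<^bsup>itP\<^esup> = 1 + (e\<^bsup>it\<^esup> - 1)P\<close> are unitary, so
  \<open>E f(e\<^bsup>itP\<^esup>U)\<close> does not depend on \<open>t\<close> and its derivative vanishes.  By linearity \<open>P\<close> may be replaced by any
  elementary matrix \<open>E\<^bsub>ab\<^esub>\<close>; taking \<open>f(U) = (U\<^sup>l)\<^bsub>ab\<^esub> g(p\<^sub>l)\<close> and summing over \<open>a, b\<close> gives the
  Schwinger--Dyson equation

  \<open>E [n p\<^sub>l g + \<Sum>\<^bsub>1\<le>j<l\<^esub> p\<^sub>j p\<^bsub>l-j\<^esub> g + l p\<^bsub>2l\<^esub> \<partial>g - l n \<partial>\<^sup>*g] = 0\<close>,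

  where \<open>\<partial>\<close> and \<open>\<partial>\<^sup>*\<close> are the Wirtinger derivatives.  With \<open>g(z) = cnj z\<close> and \<open>|p\<^sub>l| \<le> n\<close> it bounds \<open>E|p\<^sub>l|\<^sup>2\<close> by
  \<open>3\<^sup>l\<close>, uniformly in \<open>n\<close>.  With \<open>g(z) = exp(i \<xi>\<cdot>z)\<close> it shows that, up to an error \<open>O(1/n)\<close>, the
  characteristic function \<open>\<phi>(t\<xi>)\<close> of \<open>p\<^sub>l\<close> solves \<open>\<phi>' = - (l|\<xi>|\<^sup>2 t / 2) \<phi>\<close>, so that it tends to
  \<open>exp(-l|\<xi>|\<^sup>2 / 4)\<close>.  Since the second moments are bounded, this convergence suffices.\<close>

section \<open>Differentiation under the integral sign\<close>

text \<open>The mean value inequality bounds the normalized remainder \<open>q\<close> by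
  \<open>2 * C\<close>, so dominated convergence applies along every sequence tending to
  \<open>t\<close>.\<close>

lemma (in finite_measure) has_vector_derivative_integral:
  fixes f :: "real \<Rightarrow> 'a \<Rightarrow> 'b :: {banach, second_countable_topology}"
  assumes int: "\<And>s. integrable M (f s)"
    and meas: "f' t \<in> borel_measurable M"
    and der: "\<And>s x. x \<in> space M \<Longrightarrow> ((\<lambda>s. f s x) has_vector_derivative f' s x) (at s)"
    and bound: "\<And>s x. x \<in> space M \<Longrightarrow> norm (f' s x) \<le> C"
  shows "((\<lambda>s. \<integral>x. f s x \<partial>M) has_vector_derivative (\<integral>x. f' t x \<partial>M)) (at t)"
proof -
  define q where "q s x = (f s x - f t x - (s - t) *\<^sub>R f' t x) /\<^sub>R norm (s - t)" for s x
  have int': "integrable M (f' t)"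
    by (rule integrable_const_bound[of _ C]) (use meas bound in auto)
  have q_bound: "norm (q s x) \<le> 2 * C" if x: "x \<in> space M" and s: "s \<noteq> t" for s x
  proof -
    have "norm (f s x - f t x) \<le> C * norm (s - t)"
    proof (rule differentiable_bound[where S = UNIV and f' = "\<lambda>s h. h *\<^sub>R f' s x"])
      show "((\<lambda>s. f s x) has_derivative (\<lambda>h. h *\<^sub>R f' s x)) (at s within UNIV)" for s
        using der[OF x, of s] by (simp add: has_vector_derivative_def)
      show "onorm (\<lambda>h. h *\<^sub>R f' s x) \<le> C" for s
        by (intro onorm_le) (simp add: mult.commute[of _ "norm (f' s x)"] mult_right_mono[OF bound[OF x, of s]])
    qed auto
    moreover have "norm ((s - t) *\<^sub>R f' t x) \<le> C * norm (s - t)"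
      by (simp add: mult.commute[of _ "norm (f' t x)"] mult_right_mono[OF bound[OF x, of t]])
    ultimately have "norm (f s x - f t x - (s - t) *\<^sub>R f' t x) \<le> 2 * C * norm (s - t)"
      using norm_triangle_ineq4[of "f s x - f t x" "(s - t) *\<^sub>R f' t x"]
      by (simp add: algebra_simps)
    then show ?thesis using s by (simp add: q_def divide_simps mult.commute)
  qed
  have q_lim: "((\<lambda>s. q s x) \<longlongrightarrow> 0) (at t)" if "x \<in> space M" for x
    using der[OF that, of t] unfolding has_vector_derivative_def has_derivative_at_within q_def
    by (simp add: divide_inverse)
  have "((\<lambda>s. \<integral>x. q s x \<partial>M) \<longlongrightarrow> 0) (at t)"
    unfolding tendsto_at_iff_sequentially comp_def
  proof (intro allI impI)
    fix X assume X: "\<forall>i. X i \<in> UNIV - {t}" "X \<longlonglongrightarrow> t"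
    have "(\<lambda>i. \<integral>x. q (X i) x \<partial>M) \<longlonglongrightarrow> (\<integral>x. 0 \<partial>M)"
    proof (rule integral_dominated_convergence[where w = "\<lambda>_. 2 * C"])
      show "q (X i) \<in> borel_measurable M" for i
        unfolding q_def using int meas by (auto dest: borel_measurable_integrable)
      show "AE x in M. (\<lambda>i. q (X i) x) \<longlonglongrightarrow> 0"
        using q_lim X unfolding tendsto_at_iff_sequentially comp_def by (intro AE_I2) blast
    qed (use q_bound X in auto)
    then show "(\<lambda>i. \<integral>x. q (X i) x \<partial>M) \<longlonglongrightarrow> 0" by simp
  qed
  moreover have "(\<integral>x. q s x \<partial>M) =
      ((\<integral>x. f s x \<partial>M) - (\<integral>x. f t x \<partial>M) - (s - t) *\<^sub>R (\<integral>x. f' t x \<partial>M)) /\<^sub>R norm (s - t)" for s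
    unfolding q_def using int int' by simp
  ultimately show ?thesis
    unfolding has_vector_derivative_def has_derivative_at_within
    by (simp add: bounded_linear_scaleR_left divide_inverse)
qed

section \<open>Weak convergence on the plane from characteristic functions\<close>

text \<open>Frequencies range over the whole plane rather than a lattice, so every period is
  available, and integrals are finite combinations of values of the characteristic function.\<close>

inductive trig_poly :: "(complex \<Rightarrow> complex) \<Rightarrow> bool" where
  monomial: "trig_poly (\<lambda>x. c * cis (inner \<xi> x))"
| add: "trig_poly f \<Longrightarrow> trig_poly g \<Longrightarrow> trig_poly (\<lambda>x. f x + g x)"

lemma trig_poly_mult:
  assumes "trig_poly f" "trig_poly g"
  shows "trig_poly (\<lambda>x. f x * g x)"
proof -
  have *: "trig_poly (\<lambda>x. c * cis (inner \<xi> x) * g x)" for c \<xi>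
    using assms(2)
  proof induction
    case (monomial d \<eta>)
    have "(\<lambda>x. c * cis (inner \<xi> x) * (d * cis (inner \<eta> x))) = (\<lambda>x. (c * d) * cis (inner (\<xi> + \<eta>) x))"
      by (simp add: fun_eq_iff inner_add_left flip: cis_mult)
    then show ?case using trig_poly.monomial by simp
  next
    case (add f g)
    then show ?case by (simp add: distrib_left trig_poly.add)
  qed
  show ?thesis using assms(1)
    by induction (use * in \<open>auto simp: distrib_right intro: trig_poly.add\<close>)
qed

lemma trig_poly_const: "trig_poly (\<lambda>_. c)"
  using trig_poly.monomial[of c 0] by simp

lemma trig_poly_cmult: "trig_poly f \<Longrightarrow> trig_poly (\<lambda>x. c * f x)"
  by (intro trig_poly_mult trig_poly_const)

lemma trig_poly_cos: "trig_poly (\<lambda>x. of_real (cos (inner \<xi> x)))"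
proof -
  have "(\<lambda>x. of_real (cos (inner \<xi> x))) = (\<lambda>x. 1/2 * cis (inner \<xi> x) + 1/2 * cis (inner (- \<xi>) x))"
    by (auto simp: fun_eq_iff complex_eq_iff)
  then show ?thesis by (simp only: trig_poly.intros)
qed

lemma trig_poly_sin: "trig_poly (\<lambda>x. of_real (sin (inner \<xi> x)))"
proof -
  have "(\<lambda>x. of_real (sin (inner \<xi> x))) =
      (\<lambda>x. (- \<i>/2) * cis (inner \<xi> x) + (\<i>/2) * cis (inner (- \<xi>) x))"
    by (auto simp: fun_eq_iff complex_eq_iff)
  then show ?thesis by (simp only: trig_poly.intros)
qed

text \<open>The torus sits in a real space of dimension four, whose coordinates restrict to the
  cosines and sines of \<open>a * Re x\<close> and \<open>a * Im x\<close>. Linear functionals are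
  therefore trigonometric polynomials, and the closure properties do the rest.\<close>

lemma trig_poly_real_polynomial:
  fixes a :: real
  assumes "real_polynomial_function p"
  shows "trig_poly (\<lambda>x. of_real (p (cis (a * Re x), cis (a * Im x))))"
  using assms
proof induction
  case (linear h)
  interpret h: bounded_linear h by fact
  have "h (z, w) = Re z * h (1, 0) + Im z * h (\<i>, 0) + Re w * h (0, 1) + Im w * h (0, \<i>)" for z w
  proof -
    have "(z, w) = Re z *\<^sub>R (1, 0) + Im z *\<^sub>R (\<i>, 0) + Re w *\<^sub>R (0, 1) + Im w *\<^sub>R (0, \<i>)"
      by (simp add: complex_eq_iff)
    then show ?thesis by (simp only: h.add h.scaleR) simp
  qed
  note expand = this
  have "inner (of_real a) x = a * Re x" "inner (of_real a * \<i>) x = a * Im x" for x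
    by (simp_all add: inner_complex_def)
  then have "(\<lambda>x. of_real (h (cis (a * Re x), cis (a * Im x)))) =
      (\<lambda>x. of_real (h (1, 0)) * of_real (cos (inner (of_real a) x)) +
           of_real (h (\<i>, 0)) * of_real (sin (inner (of_real a) x)) +
           of_real (h (0, 1)) * of_real (cos (inner (of_real a * \<i>) x)) +
           of_real (h (0, \<i>)) * complex_of_real (sin (inner (of_real a * \<i>) x)))"
    by (intro ext, subst expand) (simp add: mult.commute)
  then show ?case
    by (simp only:) (intro trig_poly.add trig_poly_cmult trig_poly_cos trig_poly_sin)
next
  case (const c)
  show ?case by (rule trig_poly_const)
next
  case (add f g)
  then show ?case by (simp add: trig_poly.add)
next
  case (mult f g)
  then show ?case by (simp add: trig_poly_mult)
qed

lemma measurable_cis_inner [measurable]: "(\<lambda>x. cis (inner (\<xi> :: complex) x)) \<in> borel_measurable borel"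
  by (intro borel_measurable_continuous_onI continuous_intros)

lemma trig_poly_integrable:
  assumes "trig_poly f" "prob_space \<mu>" "sets \<mu> = sets borel"
  shows "integrable \<mu> f"
  using assms(1)
proof induction
  case (monomial c \<xi>)
  interpret prob_space \<mu> by fact
  have [measurable_cong]: "sets \<mu> = sets borel" by fact
  show ?case
    by (intro integrable_mult_right integrable_const_bound[of _ 1]) auto
qed auto

lemma trig_poly_integral_tendsto:
  assumes "trig_poly f"
    and "\<And>n. prob_space (\<mu> n)" "\<And>n. sets (\<mu> n) = sets borel"
    and "prob_space \<nu>" "sets \<nu> = sets borel"
    and "\<And>\<xi>. (\<lambda>n. \<integral>x. cis (inner \<xi> x) \<partial>\<mu> n) \<longlonglongrightarrow> (\<integral>x. cis (inner \<xi> x) \<partial>\<nu>)"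
  shows "(\<lambda>n. \<integral>x. f x \<partial>\<mu> n) \<longlonglongrightarrow> (\<integral>x. f x \<partial>\<nu>)"
  using assms(1)
proof induction
  case (monomial c \<xi>)
  then show ?case using assms(6)[of \<xi>] by (auto intro: tendsto_mult_left)
next
  case (add f g)
  then show ?case
    using assms(2-5) by (simp add: trig_poly_integrable Bochner_Integration.integral_add tendsto_add)
qed

text \<open>Cut \<open>f\<close> off at radius \<open>R\<close> and read the result as a continuous function on a torus of period \<open>4R\<close>,
  where Stone--Weierstrass applies.  The approximant is periodic, so beyond radius \<open>R\<close> it is only
  known to be bounded; this costs the quadratic error term.\<close>

lemma trig_poly_approx:
  fixes f :: "complex \<Rightarrow> real"
  assumes f: "continuous_on UNIV f" and fb: "\<And>x. \<bar>f x\<bar> \<le> b" and R: "R > 0" and e: "e > 0"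
  obtains g where "trig_poly (\<lambda>x. of_real (g x))"
    "\<And>x. \<bar>f x - g x\<bar> \<le> e + 2 * b * (norm x)\<^sup>2 / R\<^sup>2"
proof -
  define h where "h x = f x * max 0 (1 - (norm x)\<^sup>2 / R\<^sup>2)" for x
  have h_cont: "continuous_on UNIV h"
    unfolding h_def using f R by (auto intro!: continuous_intros)
  have h0: "h x = 0" if "norm x \<ge> R" for x
    using that R power_mono[OF that, of 2] by (simp add: h_def)
  have b0: "b \<ge> 0" using fb[of 0] by linarith
  have hb: "\<bar>h x\<bar> \<le> b" for x
  proof -
    have "max 0 (1 - (norm x)\<^sup>2 / R\<^sup>2) \<le> 1" by simp
    then show ?thesis unfolding h_def abs_mult using fb[of x] b0
      by (intro order.trans[OF mult_mono[of "\<bar>f x\<bar>" b _ 1]]) auto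
  qed
  have fh: "\<bar>f x - h x\<bar> \<le> b * (norm x)\<^sup>2 / R\<^sup>2" for x
  proof -
    have "f x - h x = f x * (1 - max 0 (1 - (norm x)\<^sup>2 / R\<^sup>2))"
      by (simp add: h_def algebra_simps)
    moreover have "\<bar>1 - max 0 (1 - (norm x)\<^sup>2 / R\<^sup>2)\<bar> \<le> (norm x)\<^sup>2 / R\<^sup>2"
      by (auto simp: max_def)
    from mult_mono[OF fb[of x] this b0]
    have "\<bar>f x * (1 - max 0 (1 - (norm x)\<^sup>2 / R\<^sup>2))\<bar> \<le> b * (norm x)\<^sup>2 / R\<^sup>2"
      by (simp add: abs_mult)
    ultimately show ?thesis by simp
  qed
  \<comment> \<open>At this scale the disc of radius \<open>R\<close> corresponds to angles below
    pi/2 in absolute value. An angle of pi/2 or more already means distance at least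
    \<open>R\<close>, where \<open>h\<close> is 0, so \<open>F\<close> vanishes well before the
    branch cut of \<open>Arg\<close>.\<close>
  define a where "a = pi / (2 * R)"
  have a: "a > 0" using R by (simp add: a_def)
  define F where "F = (\<lambda>(z, w). h (Complex (Arg z / a) (Arg w / a)))"
  define S where "S = sphere (0::complex) 1 \<times> sphere (0::complex) 1"
  \<comment> \<open>On \<open>A\<close> both coordinates avoid the cut, so \<open>F\<close> is
    continuous; on \<open>B\<close> it is 0. A unit complex number on the cut is -1, with negative
    real part, so these two open sets cover the torus.\<close>
  define A where "A = (- (\<real>\<^sub>\<le>\<^sub>0 :: complex set)) \<times> (- (\<real>\<^sub>\<le>\<^sub>0 :: complex set))"
  define B where "B = ({z. Re z < 0} \<times> UNIV) \<union> (UNIV \<times> {w. Re w < 0})"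
  have "open A" unfolding A_def by (intro open_Times open_Compl closed_nonpos_Reals_complex)
  have "open B" unfolding B_def
    by (intro open_Un open_Times open_halfspace_Re_lt open_UNIV)
  have cA: "continuous_on A F"
  proof -
    have "continuous_on (- \<real>\<^sub>\<le>\<^sub>0) Arg"
      by (intro continuous_at_imp_continuous_on ballI continuous_at_Arg) auto
    then have "continuous_on A (\<lambda>p. Complex (Arg (fst p) / a) (Arg (snd p) / a))"
      unfolding A_def Complex_eq using a
      by (intro continuous_intros continuous_on_compose2[of "- \<real>\<^sub>\<le>\<^sub>0" Arg]) auto
    then have "continuous_on A (\<lambda>p. h (Complex (Arg (fst p) / a) (Arg (snd p) / a)))"
      by (intro continuous_on_compose2[OF h_cont]) auto
    then show ?thesis by (simp add: F_def case_prod_beta')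
  qed
  have Arg_large: "\<bar>Arg z / a\<bar> \<ge> R" if "Re z < 0" for z
  proof -
    have "\<bar>Arg z\<bar> \<ge> pi / 2"
      using that Arg_Re_pos[of z] by force
    then have "(pi / 2) / a \<le> \<bar>Arg z\<bar> / a" using a by (intro divide_right_mono) auto
    moreover have "(pi / 2) / a = R" using R by (simp add: a_def)
    ultimately show ?thesis using a by (simp add: abs_divide)
  qed
  have "F p = 0" if "p \<in> B" for p
  proof -
    have "norm (Complex (Arg (fst p) / a) (Arg (snd p) / a)) \<ge> R"
      using that Arg_large[of "fst p"] Arg_large[of "snd p"]
        abs_Re_le_cmod[of "Complex (Arg (fst p) / a) (Arg (snd p) / a)"]
        abs_Im_le_cmod[of "Complex (Arg (fst p) / a) (Arg (snd p) / a)"]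
      unfolding B_def by auto
    then show ?thesis by (simp add: F_def case_prod_beta' h0)
  qed
  then have cB: "continuous_on B F"
    by (metis continuous_on_cong continuous_on_const)
  have SAB: "S \<subseteq> A \<union> B"
    unfolding S_def A_def B_def
    by (auto simp: complex_nonpos_Reals_iff) (auto simp: cmod_def)
  have "continuous_on S F"
    using continuous_on_open_Un[OF \<open>open A\<close> \<open>open B\<close> cA cB] SAB continuous_on_subset by blast
  moreover have "compact S" unfolding S_def by (intro compact_Times compact_sphere)
  ultimately obtain p where p: "real_polynomial_function p" "\<And>y. y \<in> S \<Longrightarrow> \<bar>F y - p y\<bar> < e"
    using Stone_Weierstrass_real_polynomial_function e by blast
  define E where "E x = (cis (a * Re x), cis (a * Im x))" for x
  have ES: "E x \<in> S" for x by (simp add: E_def S_def)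
  have FE: "F (E x) = h x" if x: "norm x < R" for x
  proof -
    have Arg: "Arg (cis (a * u)) = a * u" if "\<bar>u\<bar> < R" for u
    proof -
      have "\<bar>a * u\<bar> < a * R" using that a by (simp add: abs_mult)
      also have "a * R = pi / 2" using R by (simp add: a_def)
      finally show ?thesis using pi_gt_zero by (intro Arg_cis) (simp, linarith)
    qed
    show ?thesis using x abs_Re_le_cmod[of x] abs_Im_le_cmod[of x] a
      by (simp add: E_def F_def Arg complex_surj)
  qed
  have hp: "\<bar>h x - p (E x)\<bar> \<le> e + b * (norm x)\<^sup>2 / R\<^sup>2" for x
  proof (cases "norm x < R")
    case True
    then have "\<bar>h x - p (E x)\<bar> < e" using p(2)[OF ES, of x] FE[of x] by simp
    moreover have "0 \<le> b * (norm x)\<^sup>2 / R\<^sup>2" using b0 by simp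
    ultimately show ?thesis by linarith
  next
    case False
    \<comment> \<open>Here \<open>h x\<close> is 0, while \<open>p (E x)\<close> is within
      \<open>e\<close> of a value of \<open>F\<close> bounded by \<open>b\<close>; this
      \<open>b\<close> is absorbed by the quadratic term.\<close>
    then have "1 \<le> (norm x)\<^sup>2 / R\<^sup>2" using R power_mono[of R "norm x" 2] by simp
    from mult_left_mono[OF this b0] have "b \<le> b * (norm x)\<^sup>2 / R\<^sup>2" by simp
    moreover have "\<bar>F (E x)\<bar> \<le> b" using hb by (simp add: F_def E_def)
    ultimately show ?thesis using p(2)[OF ES, of x] h0[of x] False by auto
  qed
  show ?thesis
  proof
    show "trig_poly (\<lambda>x. of_real (p (E x)))"
      unfolding E_def by (rule trig_poly_real_polynomial[OF p(1)])
    show "\<bar>f x - p (E x)\<bar> \<le> e + 2 * b * (norm x)\<^sup>2 / R\<^sup>2" for x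
      using fh[of x] hp[of x] by linarith
  qed
qed

text \<open>The error of \<open>trig_poly_approx\<close> is quadratic, so its integral is bounded in
  terms of \<open>m\<close> alone, uniformly in \<open>n\<close>. The second moments thus play the
  role of tightness, and only convergence for a single trigonometric polynomial remains.\<close>

lemma weakly_convergesI_char:
  fixes \<mu> :: "nat \<Rightarrow> complex measure"
  assumes \<mu>: "\<And>n. prob_space (\<mu> n)" "\<And>n. sets (\<mu> n) = sets borel"
    and \<nu>: "prob_space \<nu>" "sets \<nu> = sets borel"
    and int: "\<And>n. integrable (\<mu> n) (\<lambda>x. (norm x)\<^sup>2)" "integrable \<nu> (\<lambda>x. (norm x)\<^sup>2)"
    and m2: "\<And>n. (\<integral>x. (norm x)\<^sup>2 \<partial>\<mu> n) \<le> m" "(\<integral>x. (norm x)\<^sup>2 \<partial>\<nu>) \<le> m"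
    and char: "\<And>\<xi>. (\<lambda>n. \<integral>x. cis (inner \<xi> x) \<partial>\<mu> n) \<longlonglongrightarrow> (\<integral>x. cis (inner \<xi> x) \<partial>\<nu>)"
  shows "weakly_converges \<mu> \<nu>"
  unfolding weakly_converges_def
proof (intro allI impI)
  fix f :: "complex \<Rightarrow> real"
  assume f: "continuous_on UNIV f" "bounded (range f)"
  then obtain b where b: "b > 0" "\<And>x. \<bar>f x\<bar> \<le> b"
    by (auto simp: bounded_pos)
  have m0: "m \<ge> 0" using m2(2) by (intro order.trans[OF _ m2(2)]) simp
  show "(\<lambda>n. \<integral>x. f x \<partial>\<mu> n) \<longlonglongrightarrow> (\<integral>x. f x \<partial>\<nu>)"
  proof (rule LIMSEQ_I)
    fix e :: real assume e: "e > 0"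
    \<comment> \<open>Chosen to make \<open>2 * b * (m + 1) / R\<^sup>2\<close> equal to
      \<open>e / 8\<close>; using \<open>m + 1\<close> keeps \<open>R\<close> positive when
      \<open>m = 0\<close>.\<close>
    define R where "R = sqrt (16 * b * (m + 1) / e)"
    have R2: "R\<^sup>2 = 16 * b * (m + 1) / e" using e b m0 by (simp add: R_def)
    have "R > 0" using e b m0 by (simp add: R_def)
    then obtain g where g: "trig_poly (\<lambda>x. of_real (g x))"
      "\<And>x. \<bar>f x - g x\<bar> \<le> e / 8 + 2 * b * (norm x)\<^sup>2 / R\<^sup>2"
      using trig_poly_approx[OF f(1) b(2), of R "e / 8"] e by auto
    have close: "\<bar>(\<integral>x. f x \<partial>\<rho>) - (\<integral>x. g x \<partial>\<rho>)\<bar> \<le> e / 4" and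
      cg: "(\<integral>x. complex_of_real (g x) \<partial>\<rho>) = of_real (\<integral>x. g x \<partial>\<rho>)"
      if \<rho>: "prob_space \<rho>" "sets \<rho> = sets borel" "integrable \<rho> (\<lambda>x. (norm x)\<^sup>2)"
        "(\<integral>x. (norm x)\<^sup>2 \<partial>\<rho>) \<le> m" for \<rho> :: "complex measure"
    proof -
      interpret prob_space \<rho> by fact
      have [measurable_cong]: "sets \<rho> = sets borel" by fact
      have [measurable]: "f \<in> borel_measurable borel"
        using f(1) by (rule borel_measurable_continuous_onI)
      have fi: "integrable \<rho> f" by (rule integrable_const_bound[of _ b]) (use b in auto)
      have gi: "integrable \<rho> g"
        using trig_poly_integrable[OF g(1) \<rho>(1,2)] by (simp add: complex_of_real_integrable_eq)
      show "(\<integral>x. complex_of_real (g x) \<partial>\<rho>) = of_real (\<integral>x. g x \<partial>\<rho>)"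
        by (rule integral_complex_of_real)
      have "\<bar>(\<integral>x. f x \<partial>\<rho>) - (\<integral>x. g x \<partial>\<rho>)\<bar> = \<bar>\<integral>x. f x - g x \<partial>\<rho>\<bar>"
        using fi gi by simp
      also have "\<dots> \<le> (\<integral>x. \<bar>f x - g x\<bar> \<partial>\<rho>)"
        by (rule integral_abs_bound)
      also have "\<dots> \<le> (\<integral>x. e / 8 + 2 * b * (norm x)\<^sup>2 / R\<^sup>2 \<partial>\<rho>)"
        using fi gi \<rho>(3) g(2) by (intro integral_mono) auto
      also have "\<dots> = e / 8 + 2 * b * (\<integral>x. (norm x)\<^sup>2 \<partial>\<rho>) / R\<^sup>2"
        using \<rho>(3) by (simp add: prob_space)
      also have "\<dots> \<le> e / 8 + 2 * b * (m + 1) / R\<^sup>2"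
        using \<rho>(4) b by (intro add_left_mono divide_right_mono mult_left_mono) auto
      also have "\<dots> = e / 4" 
      proof -
        have "2 * b * (m + 1) / R\<^sup>2 = e / 8"
          unfolding R2 using b m0 e by (simp add: divide_simps add_nonneg_eq_0_iff)
        then show ?thesis by simp
      qed
      finally show "\<bar>(\<integral>x. f x \<partial>\<rho>) - (\<integral>x. g x \<partial>\<rho>)\<bar> \<le> e / 4" .
    qed
    have "(\<lambda>n. complex_of_real (\<integral>x. g x \<partial>\<mu> n)) \<longlonglongrightarrow> of_real (\<integral>x. g x \<partial>\<nu>)"
      using trig_poly_integral_tendsto[OF g(1) \<mu> \<nu> char] cg \<mu> \<nu> int m2 by simp
    then have "(\<lambda>n. \<integral>x. g x \<partial>\<mu> n) \<longlonglongrightarrow> (\<integral>x. g x \<partial>\<nu>)"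
      by (simp only: tendsto_of_real_iff)
    \<comment> \<open>The tolerance \<open>e / 2\<close> leaves \<open>e / 4\<close> for each of the
      two replacements of \<open>f\<close> by \<open>g\<close>.\<close>
    then obtain n0 where n0: "\<And>n. n \<ge> n0 \<Longrightarrow> \<bar>(\<integral>x. g x \<partial>\<mu> n) - (\<integral>x. g x \<partial>\<nu>)\<bar> < e / 2"
      using e unfolding LIMSEQ_iff by (metis half_gt_zero real_norm_def)
    show "\<exists>n0. \<forall>n\<ge>n0. norm ((\<integral>x. f x \<partial>\<mu> n) - (\<integral>x. f x \<partial>\<nu>)) < e"
    proof (intro exI allI impI)
      fix n assume "n \<ge> n0"
      from n0[OF this] close[OF \<mu> int(1) m2(1), of n] close[OF \<nu> int(2) m2(2)]
      show "norm ((\<integral>x. f x \<partial>\<mu> n) - (\<integral>x. f x \<partial>\<nu>)) < e"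
        unfolding real_norm_def by linarith
    qed
  qed
qed

section \<open>The Haar measure on the unitary group\<close>

lemma mat_mult_entry:
  fixes A B :: "'a :: semiring_0 mat"
  assumes "A \<in> carrier_mat n m" "B \<in> carrier_mat m k" "i < n" "j < k"
  shows "(A * B) $$ (i, j) = (\<Sum>r<m. A $$ (i, r) * B $$ (r, j))"
  using assms by (auto simp: scalar_prod_def lessThan_atLeast0 intro!: sum.cong)

lemma pow_mat_add:
  fixes A :: "'a :: semiring_1 mat"
  assumes A: "A \<in> carrier_mat n n"
  shows "A ^\<^sub>m (j + k) = A ^\<^sub>m j * A ^\<^sub>m k"
proof (induction k)
  case (Suc k)
  then show ?case
    using A by (simp add: assoc_mult_mat[of _ n n _ n _ n])
qed (use A in simp)

lemma mat_adjoint_carrier: "A \<in> carrier_mat n m \<Longrightarrow> mat_adjoint A \<in> carrier_mat m n"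
  by (auto simp: mat_adjoint_def)

lemma mat_adjoint_entry:
  fixes A :: "complex mat"
  assumes "A \<in> carrier_mat n m" "i < m" "j < n"
  shows "mat_adjoint A $$ (i, j) = cnj (A $$ (j, i))"
  using assms by (simp add: mat_adjoint_def mat_of_rows_def)

lemma mat_adjoint_mult:
  fixes A B :: "complex mat"
  assumes "A \<in> carrier_mat n m" "B \<in> carrier_mat m k"
  shows "mat_adjoint (A * B) = mat_adjoint B * mat_adjoint A"
proof (rule eq_matI)
  note carriers = assms mult_carrier_mat[OF assms] mat_adjoint_carrier[OF assms(1)]
    mat_adjoint_carrier[OF assms(2)]
  show "dim_row (mat_adjoint (A * B)) = dim_row (mat_adjoint B * mat_adjoint A)"
    "dim_col (mat_adjoint (A * B)) = dim_col (mat_adjoint B * mat_adjoint A)"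
    using carriers mat_adjoint_carrier[OF carriers(3)] by auto
  fix i j assume "i < dim_row (mat_adjoint B * mat_adjoint A)" "j < dim_col (mat_adjoint B * mat_adjoint A)"
  then have "i < k" "j < n" using carriers by auto
  then show "mat_adjoint (A * B) $$ (i, j) = (mat_adjoint B * mat_adjoint A) $$ (i, j)"
    using carriers
    by (simp add: mat_adjoint_entry[of _ n k] mat_adjoint_entry[of _ n m] mat_adjoint_entry[of _ m k]
        mat_mult_entry[of _ n m _ k] mat_mult_entry[of _ k m _ n] mult.commute del: index_mult_mat(1))
qed

lemma mat_adjoint_adjoint:
  fixes A :: "complex mat"
  assumes "A \<in> carrier_mat n m"
  shows "mat_adjoint (mat_adjoint A) = A"
proof (rule eq_matI)
  note c = assms mat_adjoint_carrier[OF assms] mat_adjoint_carrier[OF mat_adjoint_carrier[OF assms]]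
  show "dim_row (mat_adjoint (mat_adjoint A)) = dim_row A"
    "dim_col (mat_adjoint (mat_adjoint A)) = dim_col A" using c by auto
  fix i j assume "i < dim_row A" "j < dim_col A"
  then show "mat_adjoint (mat_adjoint A) $$ (i, j) = A $$ (i, j)"
    using c by (simp add: mat_adjoint_entry[of _ n m] mat_adjoint_entry[of _ m n])
qed

lemma unitary_group_carrier: "A \<in> unitary_group n \<Longrightarrow> A \<in> carrier_mat n n"
  by (simp add: unitary_group_def)

lemma unitary_group_mult:
  assumes "A \<in> unitary_group n" "B \<in> unitary_group n"
  shows "A * B \<in> unitary_group n"
proof -
  note A = assms(1)[unfolded unitary_group_def, simplified]
  note B = assms(2)[unfolded unitary_group_def, simplified]
  note c = mat_adjoint_carrier[of A n n] mat_adjoint_carrier[of B n n]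
  have "mat_adjoint A * (A * B) = B" "B * (mat_adjoint B * mat_adjoint A) = mat_adjoint A"
    using A B c assoc_mult_mat[of "mat_adjoint A" n n A n B n]
      assoc_mult_mat[of B n n "mat_adjoint B" n "mat_adjoint A" n]
      left_mult_one_mat[of B n n] left_mult_one_mat[of "mat_adjoint A" n n] by simp_all
  then have "mat_adjoint B * mat_adjoint A * (A * B) = 1\<^sub>m n" "A * B * (mat_adjoint B * mat_adjoint A) = 1\<^sub>m n"
    using A B c by (simp_all add: assoc_mult_mat[of _ n n _ n _ n] mult_carrier_mat[of _ n n _ n])
  then show ?thesis
    using A B c by (simp add: unitary_group_def mat_adjoint_mult[of A n n B n] mult_carrier_mat[of A n n B n])
qed

lemma mat_adjoint_one: "mat_adjoint (1\<^sub>m n :: complex mat) = 1\<^sub>m n"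
proof (rule eq_matI)
  have c: "mat_adjoint (1\<^sub>m n :: complex mat) \<in> carrier_mat n n"
    by (simp add: mat_adjoint_carrier)
  then show "dim_row (mat_adjoint (1\<^sub>m n :: complex mat)) = dim_row (1\<^sub>m n)"
    "dim_col (mat_adjoint (1\<^sub>m n :: complex mat)) = dim_col (1\<^sub>m n)" by auto
  fix i j assume "i < dim_row (1\<^sub>m n :: complex mat)" "j < dim_col (1\<^sub>m n :: complex mat)"
  then show "mat_adjoint (1\<^sub>m n) $$ (i, j) = (1\<^sub>m n :: complex mat) $$ (i, j)"
    by (simp add: mat_adjoint_entry[of _ n n])
qed

lemma unitary_group_one: "1\<^sub>m n \<in> unitary_group n"
  by (simp add: unitary_group_def mat_adjoint_one)

lemma unitary_group_pow: "A \<in> unitary_group n \<Longrightarrow> A ^\<^sub>m k \<in> unitary_group n"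
  by (induction k) (auto simp: unitary_group_one unitary_group_mult dest: unitary_group_carrier)

lemma unitary_group_adjoint: "A \<in> unitary_group n \<Longrightarrow> mat_adjoint A \<in> unitary_group n"
  by (auto simp: unitary_group_def mat_adjoint_carrier mat_adjoint_adjoint)

lemma unitary_group_row:
  assumes "A \<in> unitary_group n" "i < n" "j < n"
  shows "(\<Sum>k<n. A $$ (i, k) * cnj (A $$ (j, k))) = (if i = j then 1 else 0)"
proof -
  note A = assms(1)[unfolded unitary_group_def, simplified]
  have "(A * mat_adjoint A) $$ (i, j) = (\<Sum>k<n. A $$ (i, k) * mat_adjoint A $$ (k, j))"
    using A assms(2,3) mat_adjoint_carrier by (intro mat_mult_entry) auto
  also have "\<dots> = (\<Sum>k<n. A $$ (i, k) * cnj (A $$ (j, k)))"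
    using A assms(2,3) by (intro sum.cong) (simp_all add: mat_adjoint_entry[of _ n n])
  finally show ?thesis using A assms(2,3) by simp
qed

lemma unitary_groupI:
  assumes A: "A \<in> carrier_mat n n"
    and "\<And>i j. i < n \<Longrightarrow> j < n \<Longrightarrow> (\<Sum>k<n. A $$ (i, k) * cnj (A $$ (j, k))) = (if i = j then 1 else 0)"
    and "\<And>i j. i < n \<Longrightarrow> j < n \<Longrightarrow> (\<Sum>k<n. cnj (A $$ (k, i)) * A $$ (k, j)) = (if i = j then 1 else 0)"
  shows "A \<in> unitary_group n"
proof -
  have c: "mat_adjoint A \<in> carrier_mat n n" using A by (rule mat_adjoint_carrier)
  have "A * mat_adjoint A = 1\<^sub>m n"
    using A c assms(2) by (intro eq_matI)
      (auto simp: mat_mult_entry[of _ n n _ n] mat_adjoint_entry[of _ n n] simp del: index_mult_mat(1))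
  moreover have "mat_adjoint A * A = 1\<^sub>m n"
    using A c assms(3) by (intro eq_matI)
      (auto simp: mat_mult_entry[of _ n n _ n] mat_adjoint_entry[of _ n n] simp del: index_mult_mat(1))
  ultimately show ?thesis using A by (simp add: unitary_group_def)
qed

lemma unitary_row_norm:
  assumes "A \<in> unitary_group n" "i < n"
  shows "(\<Sum>k<n. (norm (A $$ (i, k)))\<^sup>2) = 1"
proof -
  have "complex_of_real (\<Sum>k<n. (norm (A $$ (i, k)))\<^sup>2) = 1"
    using unitary_group_row[OF assms assms(2)]
    by (simp only: of_real_sum complex_norm_square) simp
  then show ?thesis by (simp only: of_real_eq_1_iff)
qed

lemma unitary_entry_le_1:
  assumes "A \<in> unitary_group n" "i < n" "j < n"
  shows "norm (A $$ (i, j)) \<le> 1"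
proof -
  have "(norm (A $$ (i, j)))\<^sup>2 \<le> (\<Sum>k<n. (norm (A $$ (i, k)))\<^sup>2)"
    using assms(3) by (intro member_le_sum) auto
  then show ?thesis using unitary_row_norm[OF assms(1,2)] by (simp add: power_le_one_iff abs_square_le_1)
qed

lemma mat_trace_pow:
  "A \<in> carrier_mat n n \<Longrightarrow> mat_trace (A ^\<^sub>m k) = (\<Sum>i<n. (A ^\<^sub>m k) $$ (i, i))"
  by (simp add: mat_trace_def)

text \<open>Powers stay unitary and unitary entries have modulus at most 1. The bound grows with
  \<open>n\<close>, but for fixed \<open>n\<close> it makes the functions of traces below bounded,
  hence integrable.\<close>

lemma unitary_trace_pow_le:
  assumes "A \<in> unitary_group n"
  shows "norm (mat_trace (A ^\<^sub>m k)) \<le> real n"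
proof -
  have "norm (\<Sum>i<n. (A ^\<^sub>m k) $$ (i, i)) \<le> (\<Sum>i<n. 1)"
    using unitary_entry_le_1[OF unitary_group_pow[OF assms]] by (intro sum_norm_le) auto
  then show ?thesis using assms by (simp add: mat_trace_pow[OF unitary_group_carrier])
qed

section \<open>The Borel structure of the unitary group\<close>

lemma space_unitary_borel: "space (unitary_borel n) = unitary_group n"
  and sets_unitary_borel:
    "sets (unitary_borel n) = sigma_sets (unitary_group n) {S. openin (unitary_topology n) S}"
proof -
  have "{S. openin (unitary_topology n) S} \<subseteq> Pow (unitary_group n)"
    by (auto simp: unitary_topology_def openin_pullback_topology)
  then show "space (unitary_borel n) = unitary_group n"
    "sets (unitary_borel n) = sigma_sets (unitary_group n) {S. openin (unitary_topology n) S}"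
    by (simp_all add: unitary_borel_def)
qed

lemma sets_unitary_borelI:
  assumes "open T"
  shows "{A \<in> unitary_group n. mat_entries n A \<in> T} \<in> sets (unitary_borel n)"
proof -
  have "openin (unitary_topology n) (mat_entries n -` T \<inter> unitary_group n)"
    using assms by (auto simp: unitary_topology_def openin_pullback_topology)
  then show ?thesis
    by (auto simp: sets_unitary_borel vimage_def Int_def conj_commute intro!: sigma_sets.Basic)
qed

lemma measurable_mat_entry:
  assumes "i < n" "j < n"
  shows "(\<lambda>A. A $$ (i, j)) \<in> borel_measurable (unitary_borel n)"
proof (rule borel_measurableI)
  fix T :: "complex set" assume "open T"
  then have "open ((\<lambda>m :: nat \<times> nat \<Rightarrow> complex. m (i, j)) -` T)"
    by (intro open_vimage continuous_on_product_coordinates)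
  from sets_unitary_borelI[OF this, of n] assms
  show "(\<lambda>A. A $$ (i, j)) -` T \<inter> space (unitary_borel n) \<in> sets (unitary_borel n)"
    by (simp add: space_unitary_borel mat_entries_def vimage_def Int_def conj_commute)
qed

lemma measurable_mat_pow_entry:
  assumes "i < n" "j < n"
  shows "(\<lambda>A. (A ^\<^sub>m k) $$ (i, j)) \<in> borel_measurable (unitary_borel n)"
  using assms
proof (induction k arbitrary: i j)
  case 0
  have "(\<lambda>A. (A ^\<^sub>m 0) $$ (i, j)) \<in> borel_measurable (unitary_borel n) \<longleftrightarrow>
      (\<lambda>A. (1\<^sub>m n :: complex mat) $$ (i, j)) \<in> borel_measurable (unitary_borel n)"
    by (rule measurable_cong) (auto simp: space_unitary_borel dest: unitary_group_carrier)
  then show ?case by simp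
next
  case (Suc k)
  have "(\<lambda>A. (A ^\<^sub>m Suc k) $$ (i, j)) \<in> borel_measurable (unitary_borel n) \<longleftrightarrow>
      (\<lambda>A. \<Sum>r<n. (A ^\<^sub>m k) $$ (i, r) * A $$ (r, j)) \<in> borel_measurable (unitary_borel n)"
    using Suc.prems
    by (intro measurable_cong) (auto simp: space_unitary_borel mat_mult_entry[of _ n n _ n]
        simp del: index_mult_mat(1) dest: unitary_group_carrier)
  then show ?case using Suc measurable_mat_entry by auto
qed

lemma measurable_trace_pow:
  "(\<lambda>A. mat_trace (A ^\<^sub>m k)) \<in> borel_measurable (unitary_borel n)"
proof -
  have "(\<lambda>A. mat_trace (A ^\<^sub>m k)) \<in> borel_measurable (unitary_borel n) \<longleftrightarrow>
      (\<lambda>A. \<Sum>i<n. (A ^\<^sub>m k) $$ (i, i)) \<in> borel_measurable (unitary_borel n)"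
    by (intro measurable_cong)
      (auto simp: space_unitary_borel intro!: mat_trace_pow dest: unitary_group_carrier)
  then show ?thesis using measurable_mat_pow_entry by auto
qed

lemma measurable_unitary_mult:
  assumes V: "V \<in> unitary_group n"
  shows "(\<lambda>A. V * A) \<in> measurable (unitary_borel n) (unitary_borel n)"
  unfolding unitary_borel_def[of n]
proof (rule measurable_measure_of, fold unitary_borel_def)
  show "{S. openin (unitary_topology n) S} \<subseteq> Pow (unitary_group n)"
    by (auto simp: unitary_topology_def openin_pullback_topology)
  show "(\<lambda>A. V * A) \<in> space (unitary_borel n) \<rightarrow> unitary_group n"
    using V by (auto simp: space_unitary_borel unitary_group_mult)
  fix S assume "S \<in> {S. openin (unitary_topology n) S}"
  then obtain T where T: "open T" "S = mat_entries n -` T \<inter> unitary_group n"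
    by (auto simp: unitary_topology_def openin_pullback_topology)
  \<comment> \<open>\<open>L\<close> is left multiplication by \<open>V\<close> read on entry
    families, with the same default 0 outside the index range as \<open>mat_entries\<close>. Each
    coordinate is a finite sum of coordinates, so \<open>L\<close> is continuous.\<close>
  define L where "L = (\<lambda>m :: nat \<times> nat \<Rightarrow> complex. \<lambda>ij. if fst ij < n \<and> snd ij < n
      then \<Sum>k<n. V $$ (fst ij, k) * m (k, snd ij) else 0)"
  have "continuous_on UNIV L"
    unfolding L_def
  proof (rule continuous_on_coordinatewise_then_product)
    fix ij :: "nat \<times> nat"
    show "continuous_on UNIV (\<lambda>m :: nat \<times> nat \<Rightarrow> complex. if fst ij < n \<and> snd ij < n
        then \<Sum>k<n. V $$ (fst ij, k) * m (k, snd ij) else 0)"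
      by (cases "fst ij < n \<and> snd ij < n")
        (auto intro!: continuous_intros continuous_on_product_coordinates)
  qed
  then have "open (L -` T)" using T(1) by (rule open_vimage[rotated])
  moreover have "mat_entries n (V * A) = L (mat_entries n A)" if "A \<in> unitary_group n" for A
    using V that
    by (auto simp: mat_entries_def L_def fun_eq_iff mat_mult_entry[of _ n n _ n]
        simp del: index_mult_mat(1) dest!: unitary_group_carrier)
  ultimately show "(\<lambda>A. V * A) -` S \<inter> space (unitary_borel n) \<in> sets (unitary_borel n)"
    using sets_unitary_borelI[of "L -` T" n] V T(2)
    by (auto simp: space_unitary_borel unitary_group_mult vimage_def Int_def conj_commute cong: conj_cong)
qed

section \<open>Left invariance of the Haar measure\<close>

locale haar_unitary =
  fixes n :: nat and \<mu> :: "complex mat measure"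
  assumes haar: "normalized_haar_unitary n \<mu>"
begin

sublocale prob_space \<mu>
  using haar by (simp add: normalized_haar_unitary_def)

lemma space_haar: "space \<mu> = unitary_group n"
  and sets_haar [measurable_cong]: "sets \<mu> = sets (unitary_borel n)"
  using haar by (simp_all add: normalized_haar_unitary_def)

lemma measurable_trace [measurable]: "(\<lambda>A. mat_trace (A ^\<^sub>m k)) \<in> borel_measurable \<mu>"
  using measurable_trace_pow by (simp add: measurable_cong_sets[OF sets_haar refl])

lemma measurable_pow_entry: 
  "i < n \<Longrightarrow> j < n \<Longrightarrow> (\<lambda>A. (A ^\<^sub>m k) $$ (i, j)) \<in> borel_measurable \<mu>"
  using measurable_mat_pow_entry by (simp add: measurable_cong_sets[OF sets_haar refl])

lemma measurable_mult:
  "V \<in> unitary_group n \<Longrightarrow> (\<lambda>A. V * A) \<in> measurable \<mu> \<mu>"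
  using measurable_unitary_mult by (simp add: measurable_cong_sets[OF sets_haar sets_haar])

text \<open>Invariance is given for images, while a push-forward measures preimages. Both agree
  because \<open>V\<close> is invertible: a point \<open>A\<close> of \<open>S\<close> is the image
  of \<open>mat_adjoint V * A\<close>, so \<open>S\<close> is the image of its preimage
  \<open>T\<close>.\<close>

lemma distr_mult:
  assumes V: "V \<in> unitary_group n"
  shows "distr \<mu> \<mu> (\<lambda>A. V * A) = \<mu>"
proof (rule measure_eqI)
  fix S assume "S \<in> sets (distr \<mu> \<mu> (\<lambda>A. V * A))"
  then have S: "S \<in> sets \<mu>" by simp
  define T where "T = (\<lambda>A. V * A) -` S \<inter> space \<mu>"
  have T: "T \<in> sets \<mu>" unfolding T_def using S measurable_mult[OF V] by (rule measurable_sets[rotated])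
  have "A \<in> (\<lambda>A. V * A) ` T" if A: "A \<in> S" for A
  proof (rule image_eqI)
    have A': "A \<in> unitary_group n" using A S sets.sets_into_space space_haar by blast
    have "V * (mat_adjoint V * A) = V * mat_adjoint V * A"
      using unitary_group_carrier[OF V] unitary_group_carrier[OF A'] mat_adjoint_carrier
      by (metis assoc_mult_mat)
    also have "\<dots> = A"
      using left_mult_one_mat[OF unitary_group_carrier[OF A']] V by (simp add: unitary_group_def)
    finally show *: "A = V * (mat_adjoint V * A)" by simp
    then show "mat_adjoint V * A \<in> T"
      using A A' V by (simp add: T_def space_haar unitary_group_mult unitary_group_adjoint)
  qed
  then have "S = (\<lambda>A. V * A) ` T" by (auto simp: T_def)
  moreover have "emeasure \<mu> ((\<lambda>A. V * A) ` T) = emeasure \<mu> T"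
    using haar V T by (simp add: normalized_haar_unitary_def)
  moreover have "emeasure (distr \<mu> \<mu> (\<lambda>A. V * A)) S = emeasure \<mu> T"
    unfolding T_def using S measurable_mult[OF V] by (rule emeasure_distr[rotated])
  ultimately show "emeasure (distr \<mu> \<mu> (\<lambda>A. V * A)) S = emeasure \<mu> S" by simp
qed simp

lemma integral_mult:
  fixes f :: "complex mat \<Rightarrow> complex"
  assumes "V \<in> unitary_group n" "f \<in> borel_measurable \<mu>"
  shows "(\<integral>A. f (V * A) \<partial>\<mu>) = (\<integral>A. f A \<partial>\<mu>)"
  using integral_distr[OF measurable_mult[OF assms(1)] assms(2)] distr_mult[OF assms(1)] by simp

end

section \<open>Rotations generated by projections\<close>

lemma sum_swap3:
  "(\<Sum>r\<in>A. \<Sum>c\<in>B. \<Sum>d\<in>C. f r c d) = (\<Sum>c\<in>B. \<Sum>d\<in>C. \<Sum>r\<in>A. f r c d)"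
proof -
  have "(\<Sum>r\<in>A. \<Sum>c\<in>B. \<Sum>d\<in>C. f r c d) = (\<Sum>c\<in>B. \<Sum>r\<in>A. \<Sum>d\<in>C. f r c d)"
    by (rule sum.swap)
  also have "\<dots> = (\<Sum>c\<in>B. \<Sum>d\<in>C. \<Sum>r\<in>A. f r c d)"
    by (intro sum.cong refl sum.swap)
  finally show ?thesis .
qed

text \<open>For a projection with entries \<open>p\<close> this is exp(itp): all positive powers of
  a projection coincide, which gives the exponential series this closed form.\<close>

definition mat_rotation :: "nat \<Rightarrow> (nat \<Rightarrow> nat \<Rightarrow> complex) \<Rightarrow> real \<Rightarrow> complex mat" where
  "mat_rotation n p t = mat n n (\<lambda>(i, j). (if i = j then 1 else 0) + (cis t - 1) * p i j)"

lemma mat_rotation_carrier: "mat_rotation n p t \<in> carrier_mat n n"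
  by (simp add: mat_rotation_def)

locale hermitian_projection =
  fixes n :: nat and p :: "nat \<Rightarrow> nat \<Rightarrow> complex"
  assumes hermitian: "\<And>i j. cnj (p i j) = p j i"
    and idem: "\<And>i j. i < n \<Longrightarrow> j < n \<Longrightarrow> (\<Sum>k<n. p i k * p k j) = p i j"
begin

text \<open>With \<open>c = cis t - 1\<close> and an idempotent P, the product of 1 + cP and its
  adjoint is 1 + (c + cnj c + c cnj c)P, and the bracket is |1 + c|^2 - 1 = 0.\<close>

lemma mat_rotation_unitary: "mat_rotation n p t \<in> unitary_group n"
proof (rule unitary_groupI[OF mat_rotation_carrier])
  define c where "c = cis t - 1"
  have c: "c + cnj c + c * cnj c = 0"
  proof -
    have "cis t * cnj (cis t) = 1" by (simp add: cis_cnj cis_mult)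
    then show ?thesis by (simp add: c_def algebra_simps)
  qed
  fix i j assume ij: "i < n" "j < n"
  let ?d = "\<lambda>i j. if i = j then 1 else (0::complex)"
  \<comment> \<open>Stated for arbitrary \<open>u\<close> and \<open>v\<close>, since the two
    products required for unitarity use \<open>c\<close> and \<open>cnj c\<close> in opposite
    orders.\<close>
  have s: "(\<Sum>k<n. (?d i k + u * p i k) * (?d j k + v * p k j)) =
      ?d i j + v * p i j + u * p i j + u * v * (\<Sum>k<n. p i k * p k j)" for u v
  proof -
    have "(\<Sum>k<n. (?d i k + u * p i k) * (?d j k + v * p k j)) =
        (\<Sum>k<n. (if k = i then ?d i j + v * p i j else 0) + (if k = j then u * p i j else 0) +
          u * v * (p i k * p k j))"
      by (intro sum.cong refl) (auto simp: algebra_simps)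
    then show ?thesis using ij by (simp add: sum.distrib flip: sum_distrib_left)
  qed
  have "(\<Sum>k<n. mat_rotation n p t $$ (i, k) * cnj (mat_rotation n p t $$ (j, k))) =
      (\<Sum>k<n. (?d i k + c * p i k) * (?d j k + cnj c * p k j))"
    using ij by (intro sum.cong) (auto simp: mat_rotation_def c_def hermitian)
  also have "\<dots> = ?d i j + (c + cnj c + c * cnj c) * p i j"
    unfolding s idem[OF ij] by (simp add: distrib_right)
  finally show "(\<Sum>k<n. mat_rotation n p t $$ (i, k) * cnj (mat_rotation n p t $$ (j, k))) = ?d i j"
    by (simp add: c)
  have "(\<Sum>k<n. cnj (mat_rotation n p t $$ (k, i)) * mat_rotation n p t $$ (k, j)) =
      (\<Sum>k<n. (?d i k + cnj c * p i k) * (?d j k + c * p k j))"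
    using ij by (intro sum.cong) (auto simp: mat_rotation_def c_def hermitian)
  also have "\<dots> = ?d i j + (c + cnj c + c * cnj c) * p i j"
    unfolding s idem[OF ij] by (simp add: distrib_right)
  finally show "(\<Sum>k<n. cnj (mat_rotation n p t $$ (k, i)) * mat_rotation n p t $$ (k, j)) = ?d i j"
    by (simp add: c)
qed

text \<open>Idempotence gives P exp(itP) = e^(it) P, so the derivative is i P times the rotated
  matrix itself. In this form the derivative formulas below apply at every \<open>t\<close>.\<close>

lemma mat_rotation_mult_deriv:
  assumes A: "A \<in> carrier_mat n n" and ij: "i < n" "j < n"
  shows "((\<lambda>t. (mat_rotation n p t * A) $$ (i, j)) has_vector_derivative
    \<i> * (\<Sum>c<n. p i c * (mat_rotation n p t * A) $$ (c, j))) (at t)"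
proof -
  have e: "(mat_rotation n p t * A) $$ (i, j) = A $$ (i, j) + (cis t - 1) * (\<Sum>k<n. p i k * A $$ (k, j))"
    if "i < n" for i t
  proof -
    have "(mat_rotation n p t * A) $$ (i, j) = (\<Sum>k<n. mat_rotation n p t $$ (i, k) * A $$ (k, j))"
      using A that ij by (intro mat_mult_entry[OF mat_rotation_carrier])
    also have "\<dots> = (\<Sum>k<n. (if i = k then A $$ (k, j) else 0) + (cis t - 1) * (p i k * A $$ (k, j)))"
      using that by (intro sum.cong) (auto simp: mat_rotation_def algebra_simps)
    finally show ?thesis using that by (simp add: sum.distrib sum_distrib_left)
  qed
  have "(\<Sum>c<n. p i c * (mat_rotation n p t * A) $$ (c, j)) =
      (\<Sum>c<n. p i c * A $$ (c, j)) + (cis t - 1) * (\<Sum>c<n. p i c * (\<Sum>k<n. p c k * A $$ (k, j)))"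
    by (simp add: e algebra_simps sum.distrib sum_distrib_left sum_subtractf)
  also have "(\<Sum>c<n. p i c * (\<Sum>k<n. p c k * A $$ (k, j))) = (\<Sum>k<n. \<Sum>c<n. p i c * p c k * A $$ (k, j))"
    by (subst sum.swap) (simp add: sum_distrib_left mult.assoc)
  also have "\<dots> = (\<Sum>k<n. p i k * A $$ (k, j))"
    using ij by (simp add: idem flip: sum_distrib_right)
  finally have r: "(\<Sum>c<n. p i c * (mat_rotation n p t * A) $$ (c, j)) = cis t * (\<Sum>k<n. p i k * A $$ (k, j))"
    by (simp add: algebra_simps)
  have "((\<lambda>t. A $$ (i, j) + (cis t - 1) * (\<Sum>k<n. p i k * A $$ (k, j))) has_vector_derivative
    \<i> * cis t * (\<Sum>k<n. p i k * A $$ (k, j))) (at t)"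
  proof -
    have "((\<lambda>t. cis t) has_vector_derivative \<i> * cis t) (at t)"
      unfolding cis_conv_exp
      by (auto intro!: derivative_eq_intros has_vector_derivative_real_field simp: has_vector_derivative_iexp)
    then show ?thesis by (auto intro!: derivative_eq_intros)
  qed
  then show ?thesis unfolding e[OF ij(1)] r by (simp add: mult.assoc)
qed

end

section \<open>Derivatives of matrix powers and of their traces\<close>

text \<open>Leibniz rule: replacing one factor A by i P A turns A^l into i A^j P A^(l-j), for j < l.
  The coefficients \<open>p c d\<close> are kept outside so that the direction P can be varied
  later.\<close>

lemma mat_pow_deriv:
  fixes A :: "real \<Rightarrow> complex mat"
  assumes A: "\<And>t. A t \<in> carrier_mat n n"
    and der: "\<And>i j. i < n \<Longrightarrow> j < n \<Longrightarrow>
      ((\<lambda>t. A t $$ (i, j)) has_vector_derivative \<i> * (\<Sum>c<n. p i c * A t $$ (c, j))) (at t)"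
    and ab: "a < n" "b < n"
  shows "((\<lambda>t. (A t ^\<^sub>m l) $$ (a, b)) has_vector_derivative
    \<i> * (\<Sum>c<n. \<Sum>d<n. p c d * (\<Sum>j<l. (A t ^\<^sub>m j) $$ (a, c) * (A t ^\<^sub>m (l - j)) $$ (d, b)))) (at t)"
  using ab
proof (induction l arbitrary: a b)
  case 0
  have "(A t ^\<^sub>m 0) $$ (a, b) = (1\<^sub>m n :: complex mat) $$ (a, b)" for t
    using carrier_matD(1)[OF A[of t]] by simp
  then show ?case by simp
next
  case (Suc l)
  let ?P = "\<lambda>k i j. (A t ^\<^sub>m k) $$ (i, j)"
  have P_Suc: "(A t ^\<^sub>m Suc k) $$ (i, j) = (\<Sum>r<n. (A t ^\<^sub>m k) $$ (i, r) * A t $$ (r, j))"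
    if "i < n" "j < n" for k i j t
    using that A by (simp add: mat_mult_entry[of _ n n _ n] del: index_mult_mat(1))
  have "((\<lambda>t. \<Sum>r<n. (A t ^\<^sub>m l) $$ (a, r) * A t $$ (r, b)) has_vector_derivative
     (\<Sum>r<n. ?P l a r * (\<i> * (\<Sum>c<n. p r c * A t $$ (c, b))) +
       \<i> * (\<Sum>c<n. \<Sum>d<n. p c d * (\<Sum>j<l. ?P j a c * ?P (l - j) d r)) * A t $$ (r, b))) (at t)"
    using Suc.prems by (intro has_vector_derivative_sum has_vector_derivative_mult Suc.IH der) auto
  also have "(\<Sum>r<n. ?P l a r * (\<i> * (\<Sum>c<n. p r c * A t $$ (c, b))) +
       \<i> * (\<Sum>c<n. \<Sum>d<n. p c d * (\<Sum>j<l. ?P j a c * ?P (l - j) d r)) * A t $$ (r, b)) =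
     \<i> * ((\<Sum>c<n. \<Sum>d<n. p c d * (?P l a c * A t $$ (d, b))) +
       (\<Sum>r<n. \<Sum>c<n. \<Sum>d<n. p c d * (\<Sum>j<l. ?P j a c * (?P (l - j) d r * A t $$ (r, b)))))"
    by (simp add: sum.distrib sum_distrib_left sum_distrib_right algebra_simps)
  also have "(\<Sum>r<n. \<Sum>c<n. \<Sum>d<n. p c d * (\<Sum>j<l. ?P j a c * (?P (l - j) d r * A t $$ (r, b)))) =
     (\<Sum>c<n. \<Sum>d<n. p c d * (\<Sum>j<l. ?P j a c * (\<Sum>r<n. ?P (l - j) d r * A t $$ (r, b))))"
  proof -
    have "(\<Sum>r<n. \<Sum>c<n. \<Sum>d<n. p c d * (\<Sum>j<l. ?P j a c * (?P (l - j) d r * A t $$ (r, b)))) =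
       (\<Sum>c<n. \<Sum>d<n. \<Sum>r<n. p c d * (\<Sum>j<l. ?P j a c * (?P (l - j) d r * A t $$ (r, b))))"
      by (rule sum_swap3)
    also have "\<dots> = (\<Sum>c<n. \<Sum>d<n. p c d * (\<Sum>r<n. \<Sum>j<l. ?P j a c * (?P (l - j) d r * A t $$ (r, b))))"
      by (simp add: sum_distrib_left)
    also have "\<dots> = (\<Sum>c<n. \<Sum>d<n. p c d * (\<Sum>j<l. \<Sum>r<n. ?P j a c * (?P (l - j) d r * A t $$ (r, b))))"
      by (intro sum.cong refl arg_cong2[where f = "(*)"] sum.swap)
    finally show ?thesis by (simp add: sum_distrib_left)
  qed
  also have "\<dots> = (\<Sum>c<n. \<Sum>d<n. p c d * (\<Sum>j<l. ?P j a c * ?P (Suc l - j) d b))"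
    using Suc.prems by (intro sum.cong refl arg_cong2[where f = "(*)"])
      (simp add: Suc_diff_le less_imp_le P_Suc del: pow_mat.simps)
  \<comment> \<open>Differentiating the last factor supplies the term \<open>j = l\<close>, where
    \<open>Suc l - j\<close> is 1 and the power is \<open>A t\<close>.\<close>
  also have "(\<Sum>c<n. \<Sum>d<n. p c d * (?P l a c * A t $$ (d, b))) + \<dots> =
     (\<Sum>c<n. \<Sum>d<n. p c d * (\<Sum>j<Suc l. ?P j a c * ?P (Suc l - j) d b))"
  proof -
    have "?P 1 d b = A t $$ (d, b)" if "d < n" for d
      using P_Suc[of d b t 0] that Suc.prems A[of t] by (simp add: if_distrib if_distribR cong: if_cong)
    then show ?thesis by (simp add: sum.distrib distrib_left algebra_simps del: pow_mat.simps)
  qed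
  finally show ?case using Suc.prems by (simp only: P_Suc)
qed

text \<open>By cyclicity the trace of A^j P A^(l-j) is that of P A^l for every j, hence the factor
  \<open>l\<close>.\<close>

lemma mat_trace_pow_deriv:
  fixes A :: "real \<Rightarrow> complex mat"
  assumes A: "\<And>t. A t \<in> carrier_mat n n"
    and der: "\<And>i j. i < n \<Longrightarrow> j < n \<Longrightarrow>
      ((\<lambda>t. A t $$ (i, j)) has_vector_derivative \<i> * (\<Sum>c<n. p i c * A t $$ (c, j))) (at t)"
  shows "((\<lambda>t. mat_trace (A t ^\<^sub>m l)) has_vector_derivative
    \<i> * of_nat l * (\<Sum>c<n. \<Sum>d<n. p c d * (A t ^\<^sub>m l) $$ (d, c))) (at t)"
proof -
  let ?P = "\<lambda>k i j. (A t ^\<^sub>m k) $$ (i, j)"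
  have "((\<lambda>t. mat_trace (A t ^\<^sub>m l)) has_vector_derivative
    (\<Sum>a<n. \<i> * (\<Sum>c<n. \<Sum>d<n. p c d * (\<Sum>j<l. ?P j a c * ?P (l - j) d a)))) (at t)"
    using mat_pow_deriv[OF A der] A
    by (simp only: mat_trace_pow[OF A]) (intro has_vector_derivative_sum, auto)
  also have "(\<Sum>a<n. \<i> * (\<Sum>c<n. \<Sum>d<n. p c d * (\<Sum>j<l. ?P j a c * ?P (l - j) d a))) =
    \<i> * (\<Sum>c<n. \<Sum>d<n. p c d * (\<Sum>j<l. \<Sum>a<n. ?P (l - j) d a * ?P j a c))"
  proof -
    have "(\<Sum>a<n. \<Sum>c<n. \<Sum>d<n. p c d * (\<Sum>j<l. ?P j a c * ?P (l - j) d a)) =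
       (\<Sum>c<n. \<Sum>d<n. \<Sum>a<n. p c d * (\<Sum>j<l. ?P j a c * ?P (l - j) d a))"
      by (rule sum_swap3)
    also have "\<dots> = (\<Sum>c<n. \<Sum>d<n. p c d * (\<Sum>a<n. \<Sum>j<l. ?P j a c * ?P (l - j) d a))"
      by (simp add: sum_distrib_left)
    also have "\<dots> = (\<Sum>c<n. \<Sum>d<n. p c d * (\<Sum>j<l. \<Sum>a<n. ?P j a c * ?P (l - j) d a))"
      by (intro sum.cong refl arg_cong2[where f = "(*)"] sum.swap)
    also have "\<dots> = (\<Sum>c<n. \<Sum>d<n. p c d * (\<Sum>j<l. \<Sum>a<n. ?P (l - j) d a * ?P j a c))"
      by (simp only: mult.commute)
    finally show ?thesis by (simp only: sum_distrib_left[symmetric])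
  qed
  also have "\<dots> = \<i> * (\<Sum>c<n. \<Sum>d<n. p c d * (of_nat l * ?P l d c))"
  proof -
    have "(\<Sum>a<n. ?P (l - j) d a * ?P j a c) = ?P l d c" if "c < n" "d < n" "j < l" for c d j
    proof -
      have "?P l d c = ?P (l - j + j) d c" using that by simp
      also have "\<dots> = (A t ^\<^sub>m (l - j) * A t ^\<^sub>m j) $$ (d, c)" by (simp only: pow_mat_add[OF A])
      also have "\<dots> = (\<Sum>a<n. ?P (l - j) d a * ?P j a c)"
        using that A by (intro mat_mult_entry) auto
      finally show ?thesis by simp
    qed
    then show ?thesis by simp
  qed
  finally show ?thesis by (simp add: sum_distrib_left algebra_simps)
qed

section \<open>The Schwinger--Dyson equation\<close>

text \<open>The derivative of \<open>(A\<^sup>l)\<^bsub>ab\<^esub> g(Tr A\<^sup>l)\<close> in the direction \<open>XA\<close>, for skew-Hermitian \<open>X\<close>, extended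
  complex linearly in \<open>X\<close> and evaluated at \<open>X = E\<^bsub>cd\<^esub>\<close>; \<open>\<alpha>\<close> and \<open>\<beta>\<close> are the Wirtinger derivatives of \<open>g\<close>.\<close>

definition sd_term :: "nat \<Rightarrow> (complex \<Rightarrow> complex) \<Rightarrow> (complex \<Rightarrow> complex) \<Rightarrow> (complex \<Rightarrow> complex) \<Rightarrow>
    nat \<Rightarrow> nat \<Rightarrow> nat \<Rightarrow> nat \<Rightarrow> complex mat \<Rightarrow> complex" where
  "sd_term l g \<alpha> \<beta> a b c d A =
     (\<Sum>j<l. (A ^\<^sub>m j) $$ (a, c) * (A ^\<^sub>m (l - j)) $$ (d, b)) * g (mat_trace (A ^\<^sub>m l)) +
     (A ^\<^sub>m l) $$ (a, b) * (of_nat l * (\<alpha> (mat_trace (A ^\<^sub>m l)) * (A ^\<^sub>m l) $$ (d, c) -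
        \<beta> (mat_trace (A ^\<^sub>m l)) * cnj ((A ^\<^sub>m l) $$ (c, d))))"

text \<open>Product rule for the entry and \<open>g\<close>, and chain rule for \<open>g\<close>,
  whose real differential has a part linear in \<open>h\<close> and a part linear in
  \<open>cnj h\<close>. Everything is then collected as a linear expression in
  \<open>p\<close>.\<close>

lemma sd_term_deriv:
  fixes A :: "real \<Rightarrow> complex mat" and g :: "complex \<Rightarrow> complex"
  assumes A: "\<And>t. A t \<in> carrier_mat n n"
    and der: "\<And>i j. i < n \<Longrightarrow> j < n \<Longrightarrow>
      ((\<lambda>t. A t $$ (i, j)) has_vector_derivative \<i> * (\<Sum>c<n. p i c * A t $$ (c, j))) (at t)"
    and p: "\<And>i j. cnj (p i j) = p j i"
    and g: "\<And>z. (g has_derivative (\<lambda>h. \<alpha> z * h + \<beta> z * cnj h)) (at z)"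
    and ab: "a < n" "b < n"
  shows "((\<lambda>t. (A t ^\<^sub>m l) $$ (a, b) * g (mat_trace (A t ^\<^sub>m l))) has_vector_derivative
    \<i> * (\<Sum>c<n. \<Sum>d<n. p c d * sd_term l g \<alpha> \<beta> a b c d (A t))) (at t)"
proof -
  let ?T = "mat_trace (A t ^\<^sub>m l)" and ?P = "\<lambda>k i j. (A t ^\<^sub>m k) $$ (i, j)"
  define h where "h = \<i> * of_nat l * (\<Sum>c<n. \<Sum>d<n. p c d * ?P l d c)"
  \<comment> \<open>Hermitian symmetry makes even the conjugate linear in \<open>p\<close>. It also
    accounts for the index order \<open>(c, d)\<close> in the conjugated entry, and conjugating
    \<open>\<i>\<close> for the minus sign before \<beta> in \<open>sd_term\<close>.\<close>
  have cnj_h: "cnj h = - \<i> * of_nat l * (\<Sum>c<n. \<Sum>d<n. p c d * cnj (?P l c d))"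
  proof -
    have "cnj h = - \<i> * of_nat l * (\<Sum>d<n. \<Sum>c<n. p c d * cnj (?P l c d))"
      by (simp add: h_def p)
    then show ?thesis by (subst sum.swap)
  qed
  have "((\<lambda>t. mat_trace (A t ^\<^sub>m l)) has_vector_derivative h) (at t)"
    unfolding h_def by (rule mat_trace_pow_deriv[OF A der])
  then have "((\<lambda>t. g (mat_trace (A t ^\<^sub>m l))) has_vector_derivative \<alpha> ?T * h + \<beta> ?T * cnj h) (at t)"
    unfolding has_vector_derivative_def
    by (rule has_derivative_eq_rhs[OF has_derivative_compose[OF _ g]])
      (simp add: fun_eq_iff scaleR_conv_of_real algebra_simps)
  from has_vector_derivative_mult[OF mat_pow_deriv[OF A der ab] this]
  have "((\<lambda>t. (A t ^\<^sub>m l) $$ (a, b) * g (mat_trace (A t ^\<^sub>m l))) has_vector_derivative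
     ?P l a b * (\<alpha> ?T * h + \<beta> ?T * cnj h) +
     \<i> * (\<Sum>c<n. \<Sum>d<n. p c d * (\<Sum>j<l. ?P j a c * ?P (l - j) d b)) * g ?T) (at t)" .
  also have "?P l a b * (\<alpha> ?T * h + \<beta> ?T * cnj h) +
     \<i> * (\<Sum>c<n. \<Sum>d<n. p c d * (\<Sum>j<l. ?P j a c * ?P (l - j) d b)) * g ?T =
     \<i> * (\<Sum>c<n. \<Sum>d<n. p c d * sd_term l g \<alpha> \<beta> a b c d (A t))"
  proof -
    have *: "(\<Sum>c<n. \<Sum>d<n. p c d * (S c d * G + E * (L * (x * u c d - y * v c d)))) =
        (\<Sum>c<n. \<Sum>d<n. p c d * S c d) * G + E * L * x * (\<Sum>c<n. \<Sum>d<n. p c d * u c d)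
        - E * L * y * (\<Sum>c<n. \<Sum>d<n. p c d * v c d)" for S u v :: "nat \<Rightarrow> nat \<Rightarrow> complex" and G E L x y
      by (simp add: sum_distrib_left sum_distrib_right sum.distrib sum_subtractf algebra_simps)
    show ?thesis unfolding sd_term_def * cnj_h by (simp add: h_def algebra_simps)
  qed
  finally show ?thesis .
qed

lemma two_point_sum:
  fixes F :: "nat \<Rightarrow> complex"
  assumes "c < n" "d < n"
  shows "(\<Sum>i<n. ((if i = c then x else 0) + (if i = d then y else 0)) * F i) = x * F c + y * F d"
proof -
  have "(\<Sum>i<n. ((if i = c then x else 0) + (if i = d then y else 0)) * F i) =
      (\<Sum>i<n. (if i = c then x * F c else 0) + (if i = d then y * F d else 0))"
    by (intro sum.cong) (auto simp: distrib_right)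
  then show ?thesis using assms by (simp add: sum.distrib)
qed

text \<open>Rank-one projections span all matrices.\<close>

lemma sesquilinear_eq_0:
  fixes L :: "nat \<Rightarrow> nat \<Rightarrow> complex"
  assumes L: "\<And>p. hermitian_projection n p \<Longrightarrow> (\<Sum>c<n. \<Sum>d<n. p c d * L c d) = 0"
    and cd: "c < n" "d < n"
  shows "L c d = 0"
proof -
  \<comment> \<open>The form is evaluated at the projection onto the line spanned by the unit vector
    with entries \<open>x\<close> at \<open>c\<close> and \<open>y\<close> at \<open>d\<close>.
    Allowing \<open>c = d\<close> when \<open>y = 0\<close> covers the diagonal.\<close>
  have Q: "x * (cnj x * L c c + cnj y * L c d) + y * (cnj x * L d c + cnj y * L d d) = 0"
    if cd: "c < n" "d < n" "c \<noteq> d \<or> y = 0" and xy: "x * cnj x + y * cnj y = 1" for x y c d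
  proof -
    define w where "w i = (if i = c then x else 0) + (if i = d then y else 0)" for i
    have cw: "cnj (w i) = (if i = c then cnj x else 0) + (if i = d then cnj y else 0)" for i
      by (simp add: w_def)
    have norm: "(\<Sum>k<n. cnj (w k) * w k) = 1"
      unfolding cw two_point_sum[OF cd(1,2)] using cd(3) xy by (auto simp: w_def mult.commute)
    have "hermitian_projection n (\<lambda>i j. w i * cnj (w j))"
    proof
      fix i j
      have "(\<Sum>k<n. w i * cnj (w k) * (w k * cnj (w j))) = w i * cnj (w j) * (\<Sum>k<n. cnj (w k) * w k)"
        by (simp add: sum_distrib_left mult_ac)
      then show "(\<Sum>k<n. w i * cnj (w k) * (w k * cnj (w j))) = w i * cnj (w j)" by (simp add: norm)
    qed (simp add: mult.commute)
    from L[OF this] have "(\<Sum>i<n. w i * (\<Sum>j<n. cnj (w j) * L i j)) = 0"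
      by (simp add: sum_distrib_left mult.assoc)
    then show ?thesis
      unfolding cw two_point_sum[OF cd(1,2)] unfolding w_def two_point_sum[OF cd(1,2)] .
  qed
  have diag: "L c c = 0" if "c < n" for c
    using Q[of c c 0 1] that by simp
  show ?thesis
  proof (cases "c = d")
    case False
    \<comment> \<open>The triple 3, 4, 5 gives unit vectors with rational coefficients. Relative
      phases 1 and \<open>\<i>\<close> yield the symmetric and the antisymmetric
      combination.\<close>
    then have "L c d + L d c = 0" "- L c d + L d c = 0"
      using Q[of c d "4/5" "3/5"] Q[of c d "4/5 * \<i>" "3/5"] cd diag by (simp_all add: field_simps)
    then show ?thesis by (simp add: eq_neg_iff_add_eq_0[symmetric])
  qed (use diag cd in simp)
qed

context haar_unitary
begin

lemma integrable_bounded: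
  fixes f :: "complex mat \<Rightarrow> complex"
  assumes "f \<in> borel_measurable \<mu>" "\<And>A. A \<in> unitary_group n \<Longrightarrow> norm (f A) \<le> C"
  shows "integrable \<mu> f"
  using assms by (intro integrable_const_bound[of _ C]) (auto simp: space_haar)

text \<open>By left invariance the integral of f(exp(itP) A) is constant in t, so its derivative at
  0, computed under the integral sign, vanishes. The outcome is linear in \<open>p\<close>, as
  \<open>sesquilinear_eq_0\<close> requires.\<close>

lemma integral_rotation_invariant:
  fixes f :: "complex mat \<Rightarrow> complex" and G :: "nat \<Rightarrow> nat \<Rightarrow> complex mat \<Rightarrow> complex"
  assumes p: "hermitian_projection n p"
    and f: "f \<in> borel_measurable \<mu>" "\<And>A. A \<in> unitary_group n \<Longrightarrow> norm (f A) \<le> C"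
    and G: "\<And>c d. c < n \<Longrightarrow> d < n \<Longrightarrow> G c d \<in> borel_measurable \<mu>"
      "\<And>c d A. c < n \<Longrightarrow> d < n \<Longrightarrow> A \<in> unitary_group n \<Longrightarrow> norm (G c d A) \<le> C"
    and der: "\<And>A t. A \<in> unitary_group n \<Longrightarrow> ((\<lambda>t. f (mat_rotation n p t * A)) has_vector_derivative
      \<i> * (\<Sum>c<n. \<Sum>d<n. p c d * G c d (mat_rotation n p t * A))) (at t)"
  shows "(\<Sum>c<n. \<Sum>d<n. p c d * (\<integral>A. G c d A \<partial>\<mu>)) = 0"
proof -
  interpret p: hermitian_projection n p by fact
  let ?V = "mat_rotation n p"
  define F where "F A = \<i> * (\<Sum>c<n. \<Sum>d<n. p c d * G c d A)" for A
  have F_meas: "F \<in> borel_measurable \<mu>" unfolding F_def using G(1) by auto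
  have F_bound: "norm (F A) \<le> (\<Sum>c<n. \<Sum>d<n. norm (p c d) * C)" if "A \<in> unitary_group n" for A
    unfolding F_def norm_mult using that G(2)
    by (auto intro!: sum_norm_le mult_left_mono simp: norm_mult)
  have "((\<lambda>t. \<integral>A. f (?V t * A) \<partial>\<mu>) has_vector_derivative (\<integral>A. F (?V 0 * A) \<partial>\<mu>)) (at 0)"
  proof (rule has_vector_derivative_integral)
    show "integrable \<mu> (\<lambda>A. f (?V t * A))" for t
      using measurable_compose[OF measurable_mult f(1)] f(2) p.mat_rotation_unitary
      by (intro integrable_bounded[of _ C]) (auto intro: unitary_group_mult)
    show "(\<lambda>A. F (?V 0 * A)) \<in> borel_measurable \<mu>"
      using measurable_compose[OF measurable_mult F_meas] p.mat_rotation_unitary by blast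
    show "((\<lambda>t. f (?V t * A)) has_vector_derivative F (?V t * A)) (at t)" if "A \<in> space \<mu>" for A t
      using der that unfolding F_def space_haar by blast
    show "norm (F (?V t * A)) \<le> (\<Sum>c<n. \<Sum>d<n. norm (p c d) * C)" if "A \<in> space \<mu>" for A t
      using that p.mat_rotation_unitary by (intro F_bound) (auto simp: space_haar intro: unitary_group_mult)
  qed
  moreover have "(\<lambda>t. \<integral>A. f (?V t * A) \<partial>\<mu>) = (\<lambda>t. \<integral>A. f A \<partial>\<mu>)"
    using integral_mult[OF p.mat_rotation_unitary f(1)] by simp
  ultimately have "(\<integral>A. F (?V 0 * A) \<partial>\<mu>) = 0"
    using vector_derivative_unique_at[OF _ has_vector_derivative_const] by metis
  \<comment> \<open>Invariance is used once more, to remove the rotation at time 0.\<close>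
  then have "(\<integral>A. F A \<partial>\<mu>) = 0"
    by (simp add: integral_mult[OF p.mat_rotation_unitary F_meas])
  moreover have "integrable \<mu> (G c d)" if "c < n" "d < n" for c d
    using that G by (intro integrable_bounded[of _ C]) auto
  then have "(\<integral>A. (\<Sum>c<n. \<Sum>d<n. p c d * G c d A) \<partial>\<mu>) = (\<Sum>c<n. \<Sum>d<n. p c d * (\<integral>A. G c d A \<partial>\<mu>))"
    by (subst Bochner_Integration.integral_sum; (intro Bochner_Integration.integrable_sum sum.cong refl)?)
      (auto simp: Bochner_Integration.integral_sum)
  ultimately show ?thesis by (simp add: F_def)
qed

text \<open>The rotation identity for the entry (a, b) of A^l times g(Tr A^l) holds for every
  projection; since projections span, each coefficient vanishes separately.\<close>

lemma integral_sd_term_eq_0: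
  fixes g \<alpha> \<beta> :: "complex \<Rightarrow> complex"
  assumes g: "\<And>z. (g has_derivative (\<lambda>h. \<alpha> z * h + \<beta> z * cnj h)) (at z)"
    and cont: "continuous_on UNIV \<alpha>" "continuous_on UNIV \<beta>"
    and abcd: "a < n" "b < n" "c < n" "d < n"
  shows "integrable \<mu> (sd_term l g \<alpha> \<beta> a b c d)" (is ?int)
    and "(\<integral>A. sd_term l g \<alpha> \<beta> a b c d A \<partial>\<mu>) = 0" (is ?zero)
proof -
  have g_cont: "continuous_on UNIV g"
    using g by (intro continuous_at_imp_continuous_on ballI has_derivative_continuous)
  have [measurable]: "g \<in> borel_measurable borel" "\<alpha> \<in> borel_measurable borel" "\<beta> \<in> borel_measurable borel"
    using g_cont cont by (auto intro: borel_measurable_continuous_onI)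
  \<comment> \<open>Continuity suffices for boundedness because traces stay in the disc of radius
    \<open>n\<close>; the bounds may depend on \<open>n\<close>.\<close>
  have "bounded (f ` cball 0 (real n))" if "continuous_on UNIV f" for f :: "complex \<Rightarrow> complex"
    using continuous_on_subset[OF that] by (intro compact_imp_bounded compact_continuous_image) auto
  then have "\<exists>K. \<forall>z. norm z \<le> real n \<longrightarrow> norm (f z) \<le> K" if "continuous_on UNIV f" for f :: "complex \<Rightarrow> complex"
    using that unfolding bounded_iff by (meson image_eqI mem_cball_0)
  from this[OF g_cont] this[OF cont(1)] this[OF cont(2)]
  obtain K1 K2 K3 where K: "\<And>z. norm z \<le> real n \<Longrightarrow> norm (g z) \<le> K1"
    "\<And>z. norm z \<le> real n \<Longrightarrow> norm (\<alpha> z) \<le> K2" "\<And>z. norm z \<le> real n \<Longrightarrow> norm (\<beta> z) \<le> K3"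
    by blast
  have K0: "K1 \<ge> 0" "K2 \<ge> 0" "K3 \<ge> 0"
    using order.trans[OF norm_ge_zero K(1)[of 0]] order.trans[OF norm_ge_zero K(2)[of 0]]
      order.trans[OF norm_ge_zero K(3)[of 0]] by simp_all
  define f where "f A = (A ^\<^sub>m l) $$ (a, b) * g (mat_trace (A ^\<^sub>m l))" for A
  \<comment> \<open>One constant for two purposes: \<open>K1\<close> bounds \<open>f\<close>, and
    the remaining terms bound \<open>sd_term\<close>.\<close>
  define C where "C = K1 + real l * K1 + real l * (K2 + K3)"
  have pow_le: "norm ((A ^\<^sub>m k) $$ (i, j)) \<le> 1" if "A \<in> unitary_group n" "i < n" "j < n" for A k i j
    using unitary_entry_le_1[OF unitary_group_pow] that by blast
  have f_meas: "f \<in> borel_measurable \<mu>"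
    unfolding f_def using measurable_pow_entry abcd by measurable
  have f_bound: "norm (f A) \<le> C" if A: "A \<in> unitary_group n" for A
  proof -
    have "norm (f A) \<le> 1 * K1"
      unfolding f_def norm_mult using K0 abcd A K(1) unitary_trace_pow_le[OF A] pow_le[OF A]
      by (intro mult_mono) auto
    moreover have "0 \<le> real l * K1 + real l * (K2 + K3)" using K0 by simp
    ultimately show ?thesis unfolding C_def by linarith
  qed
  have meas: "sd_term l g \<alpha> \<beta> a b c d \<in> borel_measurable \<mu>" if "c < n" "d < n" for c d
  proof -
    have [measurable]: "cnj \<in> borel_measurable borel"
      by (intro borel_measurable_continuous_onI continuous_intros)
    have "(\<lambda>A. cnj ((A ^\<^sub>m l) $$ (c, d))) \<in> borel_measurable \<mu>"
      using measurable_pow_entry[OF that] by (rule measurable_compose) measurable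
    then show ?thesis
      unfolding sd_term_def using measurable_pow_entry abcd that by measurable
  qed
  have bound: "norm (sd_term l g \<alpha> \<beta> a b c d A) \<le> C"
    if A: "A \<in> unitary_group n" and cd: "c < n" "d < n" for A c d
  proof -
    let ?T = "mat_trace (A ^\<^sub>m l)"
    have "norm (\<Sum>j<l. (A ^\<^sub>m j) $$ (a, c) * (A ^\<^sub>m (l - j)) $$ (d, b)) \<le> (\<Sum>j<l. 1)"
      using abcd cd pow_le[OF A] by (intro sum_norm_le) (auto simp: norm_mult intro!: mult_le_one)
    then have 1: "norm ((\<Sum>j<l. (A ^\<^sub>m j) $$ (a, c) * (A ^\<^sub>m (l - j)) $$ (d, b)) * g ?T) \<le> real l * K1"
      unfolding norm_mult using K(1)[OF unitary_trace_pow_le[OF A]] by (intro mult_mono) auto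
    have "norm (\<alpha> ?T * (A ^\<^sub>m l) $$ (d, c)) \<le> K2 * 1" "norm (\<beta> ?T * cnj ((A ^\<^sub>m l) $$ (c, d))) \<le> K3 * 1"
      unfolding norm_mult complex_mod_cnj using K0 cd K(2,3)[OF unitary_trace_pow_le[OF A]] pow_le[OF A]
      by (intro mult_mono; simp)+
    then have 2: "norm (\<alpha> ?T * (A ^\<^sub>m l) $$ (d, c) - \<beta> ?T * cnj ((A ^\<^sub>m l) $$ (c, d))) \<le> K2 + K3"
      using norm_triangle_ineq4[of "\<alpha> ?T * (A ^\<^sub>m l) $$ (d, c)" "\<beta> ?T * cnj ((A ^\<^sub>m l) $$ (c, d))"] by linarith
    have "norm ((A ^\<^sub>m l) $$ (a, b) * (of_nat l * (\<alpha> ?T * (A ^\<^sub>m l) $$ (d, c) - \<beta> ?T * cnj ((A ^\<^sub>m l) $$ (c, d)))))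
        \<le> 1 * (real l * (K2 + K3))"
      unfolding norm_mult[of "(A ^\<^sub>m l) $$ (a, b)"] norm_mult[of "of_nat l"]
      using 2 K0 abcd pow_le[OF A] by (intro mult_mono) auto
    with 1 show ?thesis
      unfolding sd_term_def C_def using K0 by (intro order.trans[OF norm_triangle_ineq]) linarith
  qed
  show ?int using meas bound abcd by (intro integrable_bounded[of _ C]) auto
  show ?zero
  proof (rule sesquilinear_eq_0[OF _ abcd(3,4)])
    fix p assume p: "hermitian_projection n p"
    then interpret p: hermitian_projection n p .
    show "(\<Sum>c<n. \<Sum>d<n. p c d * (\<integral>A. sd_term l g \<alpha> \<beta> a b c d A \<partial>\<mu>)) = 0"
    proof (rule integral_rotation_invariant[OF p f_meas f_bound meas bound])
      fix A :: "complex mat" and t :: real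
      assume "A \<in> unitary_group n"
      then have A: "A \<in> carrier_mat n n" by (rule unitary_group_carrier)
      show "((\<lambda>t. f (mat_rotation n p t * A)) has_vector_derivative
         \<i> * (\<Sum>c<n. \<Sum>d<n. p c d * sd_term l g \<alpha> \<beta> a b c d (mat_rotation n p t * A))) (at t)"
        unfolding f_def
        using mult_carrier_mat[OF mat_rotation_carrier A] p.mat_rotation_mult_deriv[OF A] p.hermitian abcd
        by (intro sd_term_deriv g) auto
    qed auto
  qed
qed

text \<open>Setting c = a and d = b, the first sum factors into two traces, the second closes up to
  the trace of A^(2l), and the third is the sum of the squared row norms of a unitary matrix, which
  is \<open>n\<close>.\<close>

lemma sd_term_contract:
  assumes A: "A \<in> unitary_group n"
  shows "(\<Sum>a<n. \<Sum>b<n. sd_term l g \<alpha> \<beta> a b a b A) =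
    g (mat_trace (A ^\<^sub>m l)) * (\<Sum>j<l. mat_trace (A ^\<^sub>m j) * mat_trace (A ^\<^sub>m (l - j))) +
    of_nat l * (\<alpha> (mat_trace (A ^\<^sub>m l)) * mat_trace (A ^\<^sub>m (l + l)) - of_nat n * \<beta> (mat_trace (A ^\<^sub>m l)))"
proof -
  note tr = mat_trace_pow[OF unitary_group_carrier[OF A]]
  let ?T = "mat_trace (A ^\<^sub>m l)" and ?P = "\<lambda>k i j. (A ^\<^sub>m k) $$ (i, j)"
  have "(\<Sum>a<n. \<Sum>b<n. (\<Sum>j<l. ?P j a a * ?P (l - j) b b)) =
      (\<Sum>j<l. \<Sum>a<n. \<Sum>b<n. ?P j a a * ?P (l - j) b b)"
    by (rule sum_swap3[symmetric])
  then have 1: "(\<Sum>a<n. \<Sum>b<n. (\<Sum>j<l. ?P j a a * ?P (l - j) b b)) =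
      (\<Sum>j<l. mat_trace (A ^\<^sub>m j) * mat_trace (A ^\<^sub>m (l - j)))"
    by (simp add: tr sum_product)
  have 2: "(\<Sum>a<n. \<Sum>b<n. ?P l a b * ?P l b a) = mat_trace (A ^\<^sub>m (l + l))"
  proof -
    have "?P (l + l) a a = (\<Sum>b<n. ?P l a b * ?P l b a)" if "a < n" for a
      unfolding pow_mat_add[OF unitary_group_carrier[OF A]]
      using that unitary_group_carrier[OF A] by (intro mat_mult_entry) auto
    then show ?thesis by (simp add: tr)
  qed
  have 3: "(\<Sum>a<n. \<Sum>b<n. ?P l a b * cnj (?P l a b)) = of_nat n"
    using unitary_group_row[OF unitary_group_pow[OF A]] by simp
  have *: "(\<Sum>a<n. \<Sum>b<n. S a b * G + E a b * (L * (x * u a b - y * v a b))) =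
      G * (\<Sum>a<n. \<Sum>b<n. S a b) + L * (x * (\<Sum>a<n. \<Sum>b<n. E a b * u a b) - (\<Sum>a<n. \<Sum>b<n. E a b * v a b) * y)"
    for S E u v :: "nat \<Rightarrow> nat \<Rightarrow> complex" and G L x y
    by (simp add: sum_distrib_left sum_distrib_right sum.distrib sum_subtractf algebra_simps)
  show ?thesis unfolding sd_term_def * 1 2 3 ..
qed

text \<open>Sum of the vanishing integrals over all \<open>a\<close> and \<open>b\<close>. The sum
  over \<open>j\<close> still includes \<open>j = 0\<close>, whose factor Tr A^0 = n is split off
  later by \<open>sum_trace_split\<close>.\<close>

lemma schwinger_dyson:
  fixes g \<alpha> \<beta> :: "complex \<Rightarrow> complex"
  assumes g: "\<And>z. (g has_derivative (\<lambda>h. \<alpha> z * h + \<beta> z * cnj h)) (at z)"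
    and cont: "continuous_on UNIV \<alpha>" "continuous_on UNIV \<beta>"
  shows "(\<integral>A. g (mat_trace (A ^\<^sub>m l)) * (\<Sum>j<l. mat_trace (A ^\<^sub>m j) * mat_trace (A ^\<^sub>m (l - j))) +
    of_nat l * (\<alpha> (mat_trace (A ^\<^sub>m l)) * mat_trace (A ^\<^sub>m (l + l)) -
      of_nat n * \<beta> (mat_trace (A ^\<^sub>m l))) \<partial>\<mu>) = 0"
    (is "(\<integral>A. ?F A \<partial>\<mu>) = 0")
proof -
  note sd = integral_sd_term_eq_0[OF g cont]
  have "(\<integral>A. ?F A \<partial>\<mu>) = (\<integral>A. (\<Sum>a<n. \<Sum>b<n. sd_term l g \<alpha> \<beta> a b a b A) \<partial>\<mu>)"
    by (intro Bochner_Integration.integral_cong refl) (simp add: space_haar sd_term_contract)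
  also have "\<dots> = (\<Sum>a<n. \<Sum>b<n. (\<integral>A. sd_term l g \<alpha> \<beta> a b a b A \<partial>\<mu>))"
    using sd by (subst Bochner_Integration.integral_sum; (intro Bochner_Integration.integrable_sum sum.cong refl)?)
      (auto simp: Bochner_Integration.integral_sum)
  also have "\<dots> = 0" using sd by simp
  finally show ?thesis .
qed

end

section \<open>Moment estimates\<close>

lemma inner_complex_conv: "complex_of_real (inner \<xi> z) = (cnj \<xi> * z + \<xi> * cnj z) / 2"
  by (simp add: complex_eq_iff inner_complex_def)

text \<open>The factors of \<open>h\<close> and \<open>cnj h\<close> are the Wirtinger derivatives
  fed to \<open>schwinger_dyson\<close>; they come from writing the real inner product in terms of
  \<open>z\<close> and \<open>cnj z\<close>.\<close>

lemma has_derivative_cis_inner: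
  "((\<lambda>z. cis (inner \<xi> z)) has_derivative
    (\<lambda>h. \<i> * cnj \<xi> / 2 * cis (inner \<xi> z) * h + \<i> * \<xi> / 2 * cis (inner \<xi> z) * cnj h)) (at z)"
proof -
  have "((\<lambda>z. \<i> * complex_of_real (inner \<xi> z)) has_derivative (\<lambda>h. \<i> * of_real (inner \<xi> h))) (at z)"
    by (intro bounded_linear_imp_has_derivative bounded_linear_const_mult
        bounded_linear_compose[OF bounded_linear_of_real] bounded_linear_inner_right)
  from has_derivative_compose[OF this, of exp "(*) (exp (\<i> * of_real (inner \<xi> z)))"]
  have "((\<lambda>z. exp (\<i> * of_real (inner \<xi> z))) has_derivative
      (\<lambda>h. exp (\<i> * of_real (inner \<xi> z)) * (\<i> * of_real (inner \<xi> h)))) (at z)"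
    using DERIV_exp[of "\<i> * of_real (inner \<xi> z)"] by (simp add: has_field_derivative_def)
  then show ?thesis
    unfolding cis_conv_exp by (rule has_derivative_eq_rhs)
      (simp add: fun_eq_iff inner_complex_conv field_simps)
qed

text \<open>Closes the induction for the second moments, where \<open>l\<close> plus this sum must
  not exceed the bound itself. With base 2 the sum would be 2^l - 2, leaving no room for large
  \<open>l\<close>; base 3 does.\<close>

lemma sum_three_pow: "(\<Sum>j\<in>{1..<l}. ((3::real) ^ j + 3 ^ (l - j)) / 2) \<le> 3 ^ l - real l"
  if "l \<ge> 1"
proof -
  have "(\<Sum>j\<in>{1..<l}. (3::real) ^ (l - j)) = (\<Sum>j\<in>{1..<l}. 3 ^ j)"
    by (rule sum.reindex_bij_witness[of _ "\<lambda>j. l - j" "\<lambda>j. l - j"]) auto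
  then have "(\<Sum>j\<in>{1..<l}. ((3::real) ^ j + 3 ^ (l - j)) / 2) = (\<Sum>j\<in>{1..<l}. 3 ^ j)"
    by (simp add: sum.distrib flip: sum_divide_distrib)
  also have "\<dots> \<le> 3 ^ l - real l"
    using that
  proof (induction l rule: dec_induct)
    case (step l)
    have "(3::real) ^ 1 \<le> 3 ^ l" using step.hyps by (intro power_increasing) auto
    with step show ?case by simp
  qed simp
  finally show ?thesis .
qed

context haar_unitary
begin

lemma integrable_power2_trace: "integrable \<mu> (\<lambda>A. (norm (mat_trace (A ^\<^sub>m l)))\<^sup>2)"
  by (rule integrable_const_bound[of _ "(real n)\<^sup>2"])
    (auto simp: space_haar intro!: power_mono unitary_trace_pow_le)

lemma integrable_trace_prod: "integrable \<mu> (\<lambda>A. norm (mat_trace (A ^\<^sub>m j)) * norm (mat_trace (A ^\<^sub>m k)))"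
  by (rule integrable_const_bound[of _ "real n * real n"])
    (auto simp: space_haar intro!: mult_mono unitary_trace_pow_le)

text \<open>The inequality 2xy \<le> x^2 + y^2 reduces mixed moments to second moments.\<close>

lemma integral_trace_prod_le:
  "(\<integral>A. norm (mat_trace (A ^\<^sub>m j)) * norm (mat_trace (A ^\<^sub>m k)) \<partial>\<mu>) \<le>
    ((\<integral>A. (norm (mat_trace (A ^\<^sub>m j)))\<^sup>2 \<partial>\<mu>) + (\<integral>A. (norm (mat_trace (A ^\<^sub>m k)))\<^sup>2 \<partial>\<mu>)) / 2"
proof -
  have "(\<integral>A. norm (mat_trace (A ^\<^sub>m j)) * norm (mat_trace (A ^\<^sub>m k)) \<partial>\<mu>) \<le>
      (\<integral>A. ((norm (mat_trace (A ^\<^sub>m j)))\<^sup>2 + (norm (mat_trace (A ^\<^sub>m k)))\<^sup>2) / 2 \<partial>\<mu>)"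
    using integrable_power2_trace integrable_trace_prod
    by (intro integral_mono) (auto simp: arith_geo_mean_sqrt sum_squares_bound field_simps
        intro!: order.trans[OF _ sum_squares_bound])
  then show ?thesis using integrable_power2_trace by simp
qed

lemma trace_pow_0: "A \<in> unitary_group n \<Longrightarrow> mat_trace (A ^\<^sub>m 0) = of_nat n"
  using mat_trace_pow[of A n 0] by (auto simp: dest!: unitary_group_carrier)

lemma sum_trace_split:
  assumes "A \<in> unitary_group n" "l \<ge> 1"
  shows "(\<Sum>j<l. mat_trace (A ^\<^sub>m j) * mat_trace (A ^\<^sub>m (l - j))) =
    of_nat n * mat_trace (A ^\<^sub>m l) + (\<Sum>j\<in>{1..<l}. mat_trace (A ^\<^sub>m j) * mat_trace (A ^\<^sub>m (l - j)))"
proof -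
  have "{..<l} = insert 0 {1..<l}" using assms(2) by auto
  then show ?thesis using assms(1) by (simp add: trace_pow_0 del: pow_mat.simps)
qed

text \<open>With \<open>g = cnj\<close> the Schwinger-Dyson equation reads n E|p_l|^2 + E(cnj p_l R)
  = l n, where R is a sum of products of lower traces, controlled by induction. The crude bound
  |p_l| \<le> n is affordable because the equation is divided by n.\<close>

lemma integral_power2_trace_le:
  assumes "l \<ge> 1" "n \<ge> 1"
  shows "(\<integral>A. (norm (mat_trace (A ^\<^sub>m l)))\<^sup>2 \<partial>\<mu>) \<le> 3 ^ l"
  using assms(1)
proof (induction l rule: less_induct)
  case (less l)
  let ?p = "\<lambda>k A. mat_trace (A ^\<^sub>m k)"
  let ?R = "\<lambda>A. \<Sum>j\<in>{1..<l}. ?p j A * ?p (l - j) A"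
  have [measurable]: "cnj \<in> borel_measurable borel"
    by (intro borel_measurable_continuous_onI continuous_intros)
  have R_int: "integrable \<mu> (\<lambda>A. cnj (?p l A) * ?R A)"
    by (rule integrable_bounded[of _ "real n * (\<Sum>j\<in>{1..<l}. real n * real n)"])
      (auto simp: norm_mult intro!: mult_mono sum_norm_le unitary_trace_pow_le simp del: sum_constant)
  define I where "I = (\<integral>A. (norm (?p l A))\<^sup>2 \<partial>\<mu>)"
  define J where "J = (\<integral>A. cnj (?p l A) * ?R A \<partial>\<mu>)"
  \<comment> \<open>The zero and unit factors on the right are the Wirtinger derivatives of
    \<open>cnj\<close>, displayed so that \<open>schwinger_dyson\<close> applies.\<close>
  have "(\<integral>A. of_nat n * of_real ((norm (?p l A))\<^sup>2) + cnj (?p l A) * ?R A - of_nat l * of_nat n \<partial>\<mu>) =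
      (\<integral>A. cnj (?p l A) * (\<Sum>j<l. ?p j A * ?p (l - j) A) +
        of_nat l * (0 * ?p (l + l) A - of_nat n * 1) \<partial>\<mu>)"
    using less.prems
    by (intro Bochner_Integration.integral_cong refl)
      (simp add: space_haar sum_trace_split complex_norm_square algebra_simps del: of_real_power)
  also have "\<dots> = 0"
    by (rule schwinger_dyson) (auto intro!: derivative_eq_intros)
  finally have "of_nat n * of_real I + J - of_nat l * of_nat n = 0"
    using R_int integrable_power2_trace[of l] prob_space
    by (simp add: I_def J_def complex_of_real_integrable_eq del: of_real_power)
  then have "complex_of_real (real n * (I - real l)) = - J"
  proof -
    assume *: "of_nat n * of_real I + J - of_nat l * of_nat n = 0"
    have "complex_of_real (real n * (I - real l)) = (of_nat n * of_real I + J - of_nat l * of_nat n) - J"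
      by (simp add: right_diff_distrib)
    then show ?thesis unfolding * by simp
  qed
  then have "real n * (I - real l) \<le> norm J"
    by (metis abs_ge_self norm_minus_cancel norm_of_real)
  also have "\<dots> \<le> (\<integral>A. norm (cnj (?p l A) * ?R A) \<partial>\<mu>)"
    unfolding J_def by (rule integral_norm_bound)
  \<comment> \<open>The factor \<open>cnj (?p l A)\<close> is estimated by \<open>n\<close>, which
    cancels the \<open>n\<close> on the left at the end.\<close>
  also have "\<dots> \<le> (\<integral>A. real n * (\<Sum>j\<in>{1..<l}. norm (?p j A) * norm (?p (l - j) A)) \<partial>\<mu>)"
    using R_int integrable_trace_prod
    by (intro integral_mono integrable_norm Bochner_Integration.integrable_mult_right
          Bochner_Integration.integrable_sum)
      (auto simp: space_haar norm_mult intro!: mult_mono unitary_trace_pow_le sum_norm_le sum_nonneg)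
  also have "\<dots> = real n * (\<Sum>j\<in>{1..<l}. (\<integral>A. norm (?p j A) * norm (?p (l - j) A) \<partial>\<mu>))"
    using integrable_trace_prod by (simp add: Bochner_Integration.integral_sum)
  also have "\<dots> \<le> real n * (\<Sum>j\<in>{1..<l}. (3 ^ j + 3 ^ (l - j)) / 2)"
  proof (intro mult_left_mono sum_mono order.trans[OF integral_trace_prod_le])
    fix j assume "j \<in> {1..<l}"
    then have "(\<integral>A. (norm (?p j A))\<^sup>2 \<partial>\<mu>) \<le> 3 ^ j" "(\<integral>A. (norm (?p (l - j) A))\<^sup>2 \<partial>\<mu>) \<le> 3 ^ (l - j)"
      using less.IH[of j] less.IH[of "l - j"] by auto
    then show "((\<integral>A. (norm (?p j A))\<^sup>2 \<partial>\<mu>) + (\<integral>A. (norm (?p (l - j) A))\<^sup>2 \<partial>\<mu>)) / 2 \<le> (3 ^ j + 3 ^ (l - j)) / 2"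
      by simp
  qed simp
  also have "\<dots> \<le> real n * (3 ^ l - real l)"
    using sum_three_pow[OF less.prems] by (intro mult_left_mono) auto
  finally show ?case using assms(2) by (simp add: I_def)
qed

definition char_trace :: "nat \<Rightarrow> complex \<Rightarrow> complex" where
  "char_trace l \<xi> = (\<integral>A. cis (inner \<xi> (mat_trace (A ^\<^sub>m l))) \<partial>\<mu>)"

lemma integrable_cis_trace_mult:
  "integrable \<mu> (\<lambda>A. cis (inner \<xi> (mat_trace (A ^\<^sub>m l))) * mat_trace (A ^\<^sub>m k))"
  by (rule integrable_bounded[of _ "real n"]) (auto simp: norm_mult intro!: unitary_trace_pow_le)

lemma integrable_cis_trace: "integrable \<mu> (\<lambda>A. cis (inner \<xi> (mat_trace (A ^\<^sub>m l))))"
  by (rule integrable_bounded[of _ 1]) auto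

text \<open>In the Schwinger-Dyson equation for exp(i \<xi>.z) exactly two terms carry a factor n,
  and together they are n times the quantity to be estimated. The others are bounded uniformly in n
  by the second moments.\<close>

lemma integral_cis_trace_mult_approx:
  assumes l: "l \<ge> 1" and n: "n \<ge> 1"
  shows "norm ((\<integral>A. cis (inner \<xi> (mat_trace (A ^\<^sub>m l))) * mat_trace (A ^\<^sub>m l) \<partial>\<mu>)
      - \<i> * of_nat l * \<xi> / 2 * char_trace l \<xi>) \<le> (3 ^ l + real l * norm \<xi> * 9 ^ l) / real n"
proof -
  let ?p = "\<lambda>k A. mat_trace (A ^\<^sub>m k)"
  let ?g = "\<lambda>A. cis (inner \<xi> (?p l A))"
  let ?R = "\<lambda>A. \<Sum>j\<in>{1..<l}. ?p j A * ?p (l - j) A"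
  let ?D = "(\<integral>A. ?g A * ?p l A \<partial>\<mu>) - \<i> * of_nat l * \<xi> / 2 * char_trace l \<xi>"
  have R_int: "integrable \<mu> (\<lambda>A. ?g A * ?R A)"
    by (rule integrable_bounded[of _ "(\<Sum>j\<in>{1..<l}. real n * real n)"])
      (auto simp: norm_mult intro!: mult_mono sum_norm_le unitary_trace_pow_le simp del: sum_constant)
  have "of_nat n * ?D
        + ((\<integral>A. ?g A * ?R A \<partial>\<mu>) + \<i> * of_nat l * cnj \<xi> / 2 * (\<integral>A. ?g A * ?p (l + l) A \<partial>\<mu>)) =
    (\<integral>A. of_nat n * (?g A * ?p l A) - of_nat n * (\<i> * of_nat l * \<xi> / 2) * ?g A
        + (?g A * ?R A + \<i> * of_nat l * cnj \<xi> / 2 * (?g A * ?p (l + l) A)) \<partial>\<mu>)"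
    using R_int integrable_cis_trace_mult[of \<xi> l] integrable_cis_trace[of \<xi> l]
    by (simp add: char_trace_def right_diff_distrib mult.assoc)
  also have "\<dots> = (\<integral>A. ?g A * (\<Sum>j<l. ?p j A * ?p (l - j) A) +
      of_nat l * ((\<i> * cnj \<xi> / 2 * ?g A) * ?p (l + l) A - of_nat n * (\<i> * \<xi> / 2 * ?g A)) \<partial>\<mu>)"
    using l by (intro Bochner_Integration.integral_cong refl)
      (simp add: space_haar sum_trace_split algebra_simps)
  also have "\<dots> = 0"
    by (rule schwinger_dyson[OF has_derivative_cis_inner]) (intro continuous_intros)+
  finally have eq: "of_nat n * ?D =
      - ((\<integral>A. ?g A * ?R A \<partial>\<mu>) + \<i> * of_nat l * cnj \<xi> / 2 * (\<integral>A. ?g A * ?p (l + l) A \<partial>\<mu>))"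
    by (simp only: eq_neg_iff_add_eq_0)
  have "norm (\<integral>A. ?g A * ?R A \<partial>\<mu>) \<le> (\<integral>A. norm (?g A * ?R A) \<partial>\<mu>)"
    by (rule integral_norm_bound)
  also have "\<dots> \<le> (\<integral>A. (\<Sum>j\<in>{1..<l}. norm (?p j A) * norm (?p (l - j) A)) \<partial>\<mu>)"
    using R_int integrable_trace_prod
    by (intro integral_mono integrable_norm Bochner_Integration.integrable_sum)
      (auto simp: norm_mult intro!: sum_norm_le)
  also have "\<dots> = (\<Sum>j\<in>{1..<l}. (\<integral>A. norm (?p j A) * norm (?p (l - j) A) \<partial>\<mu>))"
    using integrable_trace_prod by (simp add: Bochner_Integration.integral_sum)
  also have "\<dots> \<le> (\<Sum>j\<in>{1..<l}. (3 ^ j + 3 ^ (l - j)) / 2)"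
  proof (intro sum_mono order.trans[OF integral_trace_prod_le])
    fix j assume "j \<in> {1..<l}"
    then have "1 \<le> j" "1 \<le> l - j" by auto
    then show "((\<integral>A. (norm (?p j A))\<^sup>2 \<partial>\<mu>) + (\<integral>A. (norm (?p (l - j) A))\<^sup>2 \<partial>\<mu>)) / 2 \<le> (3 ^ j + 3 ^ (l - j)) / 2"
      using n by (intro divide_right_mono add_mono integral_power2_trace_le) auto
  qed
  also have "\<dots> \<le> 3 ^ l" using sum_three_pow[OF l] by linarith
  finally have 1: "norm (\<integral>A. ?g A * ?R A \<partial>\<mu>) \<le> 3 ^ l" .
  have "norm (\<integral>A. ?g A * ?p (l + l) A \<partial>\<mu>) \<le> (\<integral>A. norm (?g A * ?p (l + l) A) \<partial>\<mu>)"
    by (rule integral_norm_bound)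
  \<comment> \<open>Only second moments are controlled, so the first moment of Tr A^(2l) is
    dominated through x \<le> 1 + x^2. The factor 2 in the resulting bound \<open>2 * 9 ^ l\<close>
    cancels the 1/2 in the Wirtinger derivative.\<close>
  also have "\<dots> \<le> (\<integral>A. 1 + (norm (?p (l + l) A))\<^sup>2 \<partial>\<mu>)"
  proof (rule integral_mono)
    fix A :: "complex mat"
    have "0 \<le> (norm (?p (l + l) A) - 1 / 2)\<^sup>2" by simp
    then have "norm (?p (l + l) A) \<le> 1 + (norm (?p (l + l) A))\<^sup>2"
      by (simp add: power2_eq_square algebra_simps)
    then show "norm (?g A * ?p (l + l) A) \<le> 1 + (norm (?p (l + l) A))\<^sup>2" by (simp add: norm_mult)
  qed (use integrable_cis_trace_mult integrable_power2_trace in auto)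
  also have "\<dots> \<le> 1 + 3 ^ (l + l)"
    using integral_power2_trace_le[of "l + l"] integrable_power2_trace l n prob_space by simp
  also have "\<dots> \<le> 2 * 9 ^ l"
    by (simp add: power_add flip: power_mult_distrib)
  finally have 2: "norm (\<integral>A. ?g A * ?p (l + l) A \<partial>\<mu>) \<le> 2 * 9 ^ l" .
  have "real n * norm ?D = norm (of_nat n * ?D)" by (simp add: norm_mult)
  also have "\<dots> \<le> norm (\<integral>A. ?g A * ?R A \<partial>\<mu>) + norm (\<i> * of_nat l * cnj \<xi> / 2 * (\<integral>A. ?g A * ?p (l + l) A \<partial>\<mu>))"
    unfolding eq norm_minus_cancel by (rule norm_triangle_ineq)
  also have "\<dots> \<le> 3 ^ l + real l * norm \<xi> / 2 * (2 * 9 ^ l)"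
    unfolding norm_mult norm_divide using 1 2 by (intro add_mono mult_mono) auto
  finally show ?thesis using n by (simp add: field_simps)
qed

end

section \<open>Characteristic functions\<close>

lemma cis_mult_has_vector_derivative:
  "((\<lambda>t. cis (t * x)) has_vector_derivative \<i> * of_real x * cis (t * x)) (at t)"
proof -
  have "((\<lambda>t. exp (\<i> * of_real t * of_real x)) has_vector_derivative
      \<i> * of_real x * exp (\<i> * of_real t * of_real x)) (at t)"
    by (rule has_vector_derivative_real_field) (auto intro!: derivative_eq_intros)
  then show ?thesis by (simp add: cis_conv_exp mult.assoc)
qed

lemma inner_of_real_mult: "inner (of_real t * \<xi>) z = t * inner \<xi> (z::complex)"
  by (simp add: inner_complex_def algebra_simps)

context haar_unitary
begin

text \<open>Restricting to the ray through \<xi> reduces the problem to one real variable. The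
  derivative is dominated by \<open>norm \<xi> * real n\<close>, by Cauchy-Schwarz.\<close>

lemma char_trace_has_vector_derivative:
  "((\<lambda>t. char_trace l (of_real t * \<xi>)) has_vector_derivative
    (\<integral>A. \<i> * of_real (inner \<xi> (mat_trace (A ^\<^sub>m l))) * cis (inner (of_real t * \<xi>) (mat_trace (A ^\<^sub>m l))) \<partial>\<mu>)) (at t)"
  unfolding char_trace_def
proof (rule has_vector_derivative_integral)
  have [measurable]: "inner \<xi> \<in> borel_measurable borel"
    by (intro borel_measurable_continuous_onI continuous_intros)
  show "(\<lambda>A. \<i> * of_real (inner \<xi> (mat_trace (A ^\<^sub>m l))) * cis (inner (of_real t * \<xi>) (mat_trace (A ^\<^sub>m l))))
      \<in> borel_measurable \<mu>"
    by measurable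
  show "((\<lambda>s. cis (inner (of_real s * \<xi>) (mat_trace (A ^\<^sub>m l)))) has_vector_derivative
      \<i> * of_real (inner \<xi> (mat_trace (A ^\<^sub>m l))) * cis (inner (of_real s * \<xi>) (mat_trace (A ^\<^sub>m l)))) (at s)" for A s
    unfolding inner_of_real_mult by (rule cis_mult_has_vector_derivative)
  show "norm (\<i> * of_real (inner \<xi> (mat_trace (A ^\<^sub>m l))) * cis (inner (of_real s * \<xi>) (mat_trace (A ^\<^sub>m l))))
      \<le> norm \<xi> * real n" if "A \<in> space \<mu>" for A s
    using that Cauchy_Schwarz_ineq2[of \<xi> "mat_trace (A ^\<^sub>m l)"]
    by (auto simp: norm_mult space_haar intro!: unitary_trace_pow_le mult_left_mono elim!: order.trans)
qed (rule integrable_cis_trace)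

lemma char_trace_minus: "char_trace l (- \<xi>) = cnj (char_trace l \<xi>)"
  by (simp only: char_trace_def inner_minus_left cis_cnj[symmetric] Bochner_Integration.integral_cnj)

text \<open>Splitting \<xi>.p_l into its parts in p_l and cnj p_l, the first is handled by
  \<open>integral_cis_trace_mult_approx\<close> at t\<xi>, the second by its conjugate at -t\<xi>.
  The main terms add up to the drift of the Gaussian equation.\<close>

lemma char_trace_ode:
  assumes l: "l \<ge> 1" and n: "n \<ge> 1" and t: "0 \<le> t" "t \<le> 1"
  shows "norm ((\<integral>A. \<i> * of_real (inner \<xi> (mat_trace (A ^\<^sub>m l))) * cis (inner (of_real t * \<xi>) (mat_trace (A ^\<^sub>m l))) \<partial>\<mu>)
      + of_real (real l * (norm \<xi>)\<^sup>2 * t / 2) * char_trace l (of_real t * \<xi>))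
    \<le> norm \<xi> * (3 ^ l + real l * norm \<xi> * 9 ^ l) / real n"
proof -
  let ?p = "\<lambda>A. mat_trace (A ^\<^sub>m l)"
  define E where "E \<eta> = (\<integral>A. cis (inner \<eta> (?p A)) * ?p A \<partial>\<mu>)" for \<eta>
  define D where "D \<eta> = E \<eta> - \<i> * of_nat l * \<eta> / 2 * char_trace l \<eta>" for \<eta>
  define K where "K = (3 ^ l + real l * norm \<xi> * 9 ^ l) / real n"
  let ?\<eta> = "of_real t * \<xi>"
  have D_le: "norm (D \<eta>) \<le> K" if "norm \<eta> \<le> norm \<xi>" for \<eta>
  proof -
    have "norm (D \<eta>) \<le> (3 ^ l + real l * norm \<eta> * 9 ^ l) / real n"
      unfolding D_def E_def by (rule integral_cis_trace_mult_approx[OF l n])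
    also have "\<dots> \<le> K"
      unfolding K_def using that by (intro divide_right_mono add_left_mono mult_right_mono mult_left_mono) auto
    finally show ?thesis .
  qed
  have E_cnj: "(\<integral>A. cis (inner \<eta> (?p A)) * cnj (?p A) \<partial>\<mu>) = cnj (E (- \<eta>))" for \<eta>
  proof -
    have "cis (inner \<eta> z) * cnj z = cnj (cis (inner (- \<eta>) z) * z)" for z by (simp add: cis_cnj)
    then show ?thesis by (simp only: E_def Bochner_Integration.integral_cnj)
  qed
  have int: "integrable \<mu> (\<lambda>A. cis (inner \<eta> (?p A)) * ?p A)" for \<eta>
    by (rule integrable_cis_trace_mult)
  have int': "integrable \<mu> (\<lambda>A. cis (inner \<eta> (?p A)) * cnj (?p A))" for \<eta>
    using int[of "- \<eta>", THEN complex_integrable_cnj[THEN iffD2]] by (simp add: cis_cnj)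
  have "(\<integral>A. \<i> * of_real (inner \<xi> (?p A)) * cis (inner ?\<eta> (?p A)) \<partial>\<mu>) =
      (\<integral>A. \<i> / 2 * (cnj \<xi> * (cis (inner ?\<eta> (?p A)) * ?p A) + \<xi> * (cis (inner ?\<eta> (?p A)) * cnj (?p A))) \<partial>\<mu>)"
    by (intro Bochner_Integration.integral_cong refl) (simp add: inner_complex_conv field_simps)
  also have "\<dots> = \<i> / 2 * (cnj \<xi> * E ?\<eta> + \<xi> * cnj (E (- ?\<eta>)))"
    unfolding E_cnj[symmetric] unfolding E_def using int int' by simp
  also have "\<dots> = \<i> / 2 * (cnj \<xi> * D ?\<eta> + \<xi> * cnj (D (- ?\<eta>)))
      - of_nat l * of_real t * (\<xi> * cnj \<xi>) / 2 * char_trace l ?\<eta>"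
    by (simp add: D_def char_trace_minus field_simps)
  also have "of_nat l * of_real t * (\<xi> * cnj \<xi>) / 2 = complex_of_real (real l * (norm \<xi>)\<^sup>2 * t / 2)"
    by (simp add: complex_norm_square[symmetric])
  finally have "(\<integral>A. \<i> * of_real (inner \<xi> (?p A)) * cis (inner ?\<eta> (?p A)) \<partial>\<mu>)
      + of_real (real l * (norm \<xi>)\<^sup>2 * t / 2) * char_trace l ?\<eta> =
      \<i> / 2 * (cnj \<xi> * D ?\<eta> + \<xi> * cnj (D (- ?\<eta>)))"
    by simp
  also have "norm \<dots> = norm (cnj \<xi> * D ?\<eta> + \<xi> * cnj (D (- ?\<eta>))) / 2"
    by (simp add: norm_mult norm_divide)
  also have "\<dots> \<le> (norm \<xi> * K + norm \<xi> * K) / 2"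
  proof (intro divide_right_mono order.trans[OF norm_triangle_ineq] add_mono)
    \<comment> \<open>The restriction to \<open>t\<close> in [0, 1] lets the error constant at \<xi>
      serve along the whole ray.\<close>
    have "norm ?\<eta> \<le> norm \<xi>" using t by (simp add: norm_mult mult_left_le_one_le)
    then show "norm (cnj \<xi> * D ?\<eta>) \<le> norm \<xi> * K" "norm (\<xi> * cnj (D (- ?\<eta>))) \<le> norm \<xi> * K"
      using D_le[of ?\<eta>] D_le[of "- ?\<eta>"] by (auto simp: norm_mult intro!: mult_left_mono)
  qed simp
  finally show ?thesis by (simp add: K_def)
qed

text \<open>Integrating factor: \<open>\<psi>\<close> is exp(c t^2) times the characteristic
  function on the ray, so its derivative is exp(c t^2) times the defect bounded in
  \<open>char_trace_ode\<close>. The mean value inequality on [0, 1], starting from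
  \<open>\<psi> 0 = 1\<close>, gives an error exp(c) K, and dividing by exp(c) leaves K.\<close>

lemma char_trace_approx:
  assumes l: "l \<ge> 1" and n: "n \<ge> 1"
  shows "norm (char_trace l \<xi> - of_real (exp (- real l * (norm \<xi>)\<^sup>2 / 4)))
    \<le> norm \<xi> * (3 ^ l + real l * norm \<xi> * 9 ^ l) / real n"
proof -
  define c where "c = real l * (norm \<xi>)\<^sup>2 / 4"
  define K where "K = norm \<xi> * (3 ^ l + real l * norm \<xi> * 9 ^ l) / real n"
  define \<phi>' where "\<phi>' t = (\<integral>A. \<i> * of_real (inner \<xi> (mat_trace (A ^\<^sub>m l))) *
    cis (inner (of_real t * \<xi>) (mat_trace (A ^\<^sub>m l))) \<partial>\<mu>)" for t
  define \<psi> where "\<psi> t = of_real (exp (c * t\<^sup>2)) * char_trace l (of_real t * \<xi>)" for t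
  define \<psi>' where "\<psi>' t = of_real (exp (c * t\<^sup>2)) * (\<phi>' t + of_real (2 * c * t) * char_trace l (of_real t * \<xi>))" for t
  have c0: "c \<ge> 0" by (simp add: c_def)
  have "(\<psi> has_vector_derivative \<psi>' t) (at t)" for t
  proof -
    have "((\<lambda>t. complex_of_real (exp (c * t\<^sup>2))) has_vector_derivative of_real (exp (c * t\<^sup>2) * (2 * c * t))) (at t)"
      by (intro has_vector_derivative_of_real)
        (auto intro!: derivative_eq_intros simp flip: has_real_derivative_iff_has_vector_derivative)
    from has_vector_derivative_mult[OF this char_trace_has_vector_derivative[of l \<xi> t]]
    show ?thesis unfolding \<psi>_def[abs_def] \<psi>'_def \<phi>'_def by (simp add: algebra_simps)
  qed
  then have "norm (\<psi> 1 - \<psi> 0) \<le> exp c * K * norm (1 - 0 :: real)"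
  proof (intro differentiable_bound[where S = "{0..1}" and f = \<psi> and f' = "\<lambda>t h. h *\<^sub>R \<psi>' t"])
    fix t :: real assume t: "t \<in> {0..1}"
    have "norm (\<psi>' t) \<le> exp c * K"
    proof -
      have "norm (\<phi>' t + of_real (2 * c * t) * char_trace l (of_real t * \<xi>)) \<le> K"
        using char_trace_ode[OF l n, of t \<xi>] t by (simp add: \<phi>'_def c_def K_def)
      moreover have "exp (c * t\<^sup>2) \<le> exp c"
        using t c0 power_le_one[of t 2] by (simp add: mult_left_le)
      ultimately show ?thesis unfolding \<psi>'_def norm_mult by (intro mult_mono) auto
    qed
    from mult_right_mono[OF this] show "onorm (\<lambda>h. h *\<^sub>R \<psi>' t) \<le> exp c * K"
      by (intro onorm_le) (simp add: mult.commute[of _ "norm (\<psi>' t)"])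
  qed (auto simp: has_vector_derivative_def intro: has_derivative_at_withinI)
  moreover have "\<psi> 0 = 1" by (simp add: \<psi>_def char_trace_def prob_space)
  moreover have "\<psi> 1 = of_real (exp c) * char_trace l \<xi>" by (simp add: \<psi>_def)
  ultimately have "norm (of_real (exp c) * char_trace l \<xi> - 1) \<le> exp c * K" by simp
  also have "of_real (exp c) * char_trace l \<xi> - 1 =
      of_real (exp c) * (char_trace l \<xi> - of_real (exp (- c)))"
    by (simp add: right_diff_distrib exp_minus flip: of_real_mult)
  finally have "norm (char_trace l \<xi> - of_real (exp (- c))) \<le> K"
    by (simp add: norm_mult)
  then show ?thesis by (simp add: c_def K_def)
qed

end

section \<open>The Gaussian limit law\<close>

text \<open>Rescaling by the standard deviation reduces both claims to the standard normal
  distribution.\<close>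

lemma (in prob_space) normal_variance_half_char:
  assumes "distributed M lborel X (normal_density 0 (sqrt (1 / 2)))"
  shows "(\<integral>\<omega>. cis (a * X \<omega>) \<partial>M) = of_real (exp (- (a\<^sup>2) / 4))"
    and "integrable M (\<lambda>\<omega>. (X \<omega>)\<^sup>2)"
proof -
  let ?s = "sqrt (1 / 2)"
  define Y where "Y \<omega> = X \<omega> / ?s" for \<omega>
  have X: "X \<omega> = ?s * Y \<omega>" for \<omega> by (simp add: Y_def)
  have Y: "distributed M lborel Y std_normal_density"
    using assms normal_standard_normal_convert[of ?s X 0] by (simp add: Y_def[abs_def])
  have [measurable]: "Y \<in> borel_measurable M" using distributed_measurable[OF Y] by simp
  have D: "distr M lborel Y = std_normal_distribution"
    by (rule distributed_distr_eq_density[OF Y])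
  have "(\<integral>\<omega>. cis (a * X \<omega>) \<partial>M) = (\<integral>\<omega>. cis (a * ?s * Y \<omega>) \<partial>M)"
    by (simp add: X mult.assoc)
  also have "\<dots> = (\<integral>y. cis (a * ?s * y) \<partial>distr M lborel Y)"
    by (subst integral_distr) (auto intro!: borel_measurable_continuous_onI continuous_intros)
  also have "\<dots> = char std_normal_distribution (a * ?s)"
    by (simp add: D char_def cis_conv_exp)
  also have "\<dots> = of_real (exp (- (a\<^sup>2) / 4))"
    unfolding char_std_normal_distribution by (simp add: power_mult_distrib power_divide)
  finally show "(\<integral>\<omega>. cis (a * X \<omega>) \<partial>M) = of_real (exp (- (a\<^sup>2) / 4))" .
  have "integrable (distr M lborel Y) (\<lambda>y. y\<^sup>2)"
    unfolding D by (rule integrable_std_normal_distribution_moment)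
  then have "integrable M (\<lambda>\<omega>. (Y \<omega>)\<^sup>2)" by (subst (asm) integrable_distr_eq) auto
  then show "integrable M (\<lambda>\<omega>. (X \<omega>)\<^sup>2)" unfolding X power_mult_distrib by simp
qed

text \<open>Independence factors the characteristic function over real and imaginary parts, and the
  two exponents add up to the squared norm of \<xi>.\<close>

lemma (in prob_space) standard_complex_normal_char:
  assumes Z: "standard_complex_normal M Z"
  shows "(\<integral>\<omega>. cis (inner \<xi> (Z \<omega>)) \<partial>M) = of_real (exp (- (norm \<xi>)\<^sup>2 / 4))"
    and "integrable M (\<lambda>\<omega>. (norm (Z \<omega>))\<^sup>2)"
proof -
  let ?X = "\<lambda>\<omega>. Re (Z \<omega>)" and ?Y = "\<lambda>\<omega>. Im (Z \<omega>)"
  have [measurable]: "Z \<in> borel_measurable M" and indep: "indep_var borel ?X borel ?Y"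
    and X: "distributed M lborel ?X (normal_density 0 (sqrt (1 / 2)))"
    and Y: "distributed M lborel ?Y (normal_density 0 (sqrt (1 / 2)))"
    using Z by (auto simp: standard_complex_normal_def)
  have cis_meas [measurable]: "(\<lambda>x. cis (a * x)) \<in> borel_measurable borel" for a :: real
    by (intro borel_measurable_continuous_onI continuous_intros)
  have "indep_var borel ((\<lambda>x. cis (Re \<xi> * x)) \<circ> ?X) borel ((\<lambda>y. cis (Im \<xi> * y)) \<circ> ?Y)"
    by (rule indep_var_compose[OF indep]) measurable
  then have "(\<integral>\<omega>. cis (Re \<xi> * ?X \<omega>) * cis (Im \<xi> * ?Y \<omega>) \<partial>M) =
      (\<integral>\<omega>. cis (Re \<xi> * ?X \<omega>) \<partial>M) * (\<integral>\<omega>. cis (Im \<xi> * ?Y \<omega>) \<partial>M)"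
    unfolding comp_def
    by (rule indep_var_lebesgue_integral) (auto intro!: integrable_const_bound[of _ 1])
  also have "\<dots> = of_real (exp (- ((Re \<xi>)\<^sup>2) / 4) * exp (- ((Im \<xi>)\<^sup>2) / 4))"
    by (simp add: normal_variance_half_char(1)[OF X] normal_variance_half_char(1)[OF Y])
  also have "exp (- ((Re \<xi>)\<^sup>2) / 4) * exp (- ((Im \<xi>)\<^sup>2) / 4) = exp (- (norm \<xi>)\<^sup>2 / 4)"
    by (simp add: cmod_power2 field_simps flip: exp_add)
  finally show "(\<integral>\<omega>. cis (inner \<xi> (Z \<omega>)) \<partial>M) = of_real (exp (- (norm \<xi>)\<^sup>2 / 4))"
    by (simp add: inner_complex_def cis_mult)
  show "integrable M (\<lambda>\<omega>. (norm (Z \<omega>))\<^sup>2)"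
    using normal_variance_half_char(2)[OF X] normal_variance_half_char(2)[OF Y] by (simp add: cmod_power2)
qed

section \<open>Convergence in distribution of the traces\<close>

theorem theorem4p1:
  fixes l :: nat
    and M :: "nat \<Rightarrow> 'a measure" and U :: "nat \<Rightarrow> 'a \<Rightarrow> complex mat"
    and N :: "'b measure" and Z :: "'b \<Rightarrow> complex"
  assumes "l \<ge> 1"
    and "prob_space N" and "standard_complex_normal N Z"
    and "\<And>n. n \<ge> 1 \<Longrightarrow> prob_space (M n)"
    and "\<And>n. n \<ge> 1 \<Longrightarrow> haar_unitary_random_matrix n (M n) (U n)"
  shows "converges_in_distribution M (\<lambda>n \<omega>. mat_trace (U n \<omega> ^\<^sub>m l))
           N (\<lambda>\<omega>. complex_of_real (sqrt (real l)) * Z \<omega>)"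
proof -
  interpret N: prob_space N by fact
  define H where "H n = distr (M n) (unitary_borel n) (U n)" for n
  define W where "W n = distr (M n) borel (\<lambda>\<omega>. mat_trace (U n \<omega> ^\<^sub>m l))" for n
  define \<nu> where "\<nu> = distr N borel (\<lambda>\<omega>. complex_of_real (sqrt (real l)) * Z \<omega>)"
  have haar: "haar_unitary n (H n)" if "n \<ge> 1" for n
    using assms(5)[OF that] by (simp add: haar_unitary_random_matrix_def haar_unitary_def H_def)
  \<comment> \<open>The law of the trace depends on \<open>U n\<close> only through its distribution
    \<open>H n\<close>, so the estimates for Haar measure carry over.\<close>
  have W: "W n = distr (H n) borel (\<lambda>A. mat_trace (A ^\<^sub>m l))" if "n \<ge> 1" for n
    using assms(5)[OF that] unfolding W_def H_def haar_unitary_random_matrix_def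
    by (subst distr_distr[OF measurable_trace_pow]) (auto simp: comp_def)
  have [measurable]: "Z \<in> borel_measurable N" using assms(3) by (simp add: standard_complex_normal_def)
  have \<nu>_char: "(\<integral>x. cis (inner \<xi> x) \<partial>\<nu>) = of_real (exp (- real l * (norm \<xi>)\<^sup>2 / 4))" for \<xi>
  proof -
    have "(\<integral>x. cis (inner \<xi> x) \<partial>\<nu>) = (\<integral>\<omega>. cis (inner \<xi> (of_real (sqrt (real l)) * Z \<omega>)) \<partial>N)"
      unfolding \<nu>_def by (rule integral_distr) measurable
    moreover have "inner \<xi> (of_real (sqrt (real l)) * Z \<omega>) = inner (of_real (sqrt (real l)) * \<xi>) (Z \<omega>)" for \<omega>
      by (simp add: inner_complex_def algebra_simps)
    ultimately show ?thesis
      by (simp add: N.standard_complex_normal_char(1)[OF assms(3)] norm_mult power_mult_distrib)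
  qed
  have \<nu>_int: "integrable \<nu> (\<lambda>x. (norm x)\<^sup>2)"
    unfolding \<nu>_def using N.standard_complex_normal_char(2)[OF assms(3)]
    by (subst integrable_distr_eq) (auto simp: norm_mult power_mult_distrib)
  \<comment> \<open>A common second moment bound: \<open>3 ^ l\<close> covers all the trace laws,
    the integral covers the limit.\<close>
  define m where "m = max (3 ^ l) (\<integral>x. (norm x)\<^sup>2 \<partial>\<nu>)"
  \<comment> \<open>The hypotheses say nothing about index 0, so the shifted sequence is treated
    first; the shift does not affect the limit.\<close>
  have "weakly_converges (\<lambda>n. W (Suc n)) \<nu>"
  proof (rule weakly_convergesI_char)
    fix n :: nat
    interpret haar_unitary "Suc n" "H (Suc n)" by (rule haar) simp
    show "prob_space (W (Suc n))" by (simp add: W prob_space_distr)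
    show "integrable (W (Suc n)) (\<lambda>x. (norm x)\<^sup>2)"
      using integrable_power2_trace by (simp add: W integrable_distr_eq)
    show "(\<integral>x. (norm x)\<^sup>2 \<partial>W (Suc n)) \<le> m"
      using integral_power2_trace_le[OF assms(1)] by (simp add: W integral_distr m_def)
  next
    fix \<xi> :: complex
    define K where "K = norm \<xi> * (3 ^ l + real l * norm \<xi> * 9 ^ l)"
    have "norm ((\<integral>x. cis (inner \<xi> x) \<partial>W (Suc n)) - (\<integral>x. cis (inner \<xi> x) \<partial>\<nu>)) \<le> K / real (Suc n)" for n
    proof -
      interpret haar_unitary "Suc n" "H (Suc n)" by (rule haar) simp
      have "(\<integral>x. cis (inner \<xi> x) \<partial>W (Suc n)) = char_trace l \<xi>"
        by (simp add: W integral_distr char_trace_def)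
      then show ?thesis using char_trace_approx[OF assms(1), of \<xi>] by (simp add: \<nu>_char K_def)
    qed
    moreover have "(\<lambda>n. K / real (Suc n)) \<longlonglongrightarrow> 0"
      by (rule LIMSEQ_Suc[OF lim_const_over_n])
    ultimately have "(\<lambda>n. (\<integral>x. cis (inner \<xi> x) \<partial>W (Suc n)) - (\<integral>x. cis (inner \<xi> x) \<partial>\<nu>)) \<longlonglongrightarrow> 0"
      by (intro Lim_null_comparison[OF _ \<open>(\<lambda>n. K / real (Suc n)) \<longlonglongrightarrow> 0\<close>]) auto
    then show "(\<lambda>n. \<integral>x. cis (inner \<xi> x) \<partial>W (Suc n)) \<longlonglongrightarrow> (\<integral>x. cis (inner \<xi> x) \<partial>\<nu>)"
      by (simp only: LIM_zero_iff)
  qed (use \<nu>_int in \<open>auto simp: m_def W_def \<nu>_def intro!: N.prob_space_distr\<close>)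
  then show ?thesis
    unfolding converges_in_distribution_def W_def[symmetric] \<nu>_def[symmetric] weakly_converges_def
    by (blast intro: LIMSEQ_imp_Suc)
qed

end
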